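(* Let $(\phi_t)_{t\ge 0}$ be a non-elliptic semigroup of holomorphic self-maps of the unit disk $\mathbb{D}$, with orthogonal speed $v^o$. Then the function $v^o$ is strictly increasing in $[0,+\infty)$.
   Context: $\mathbb{D}=\{z\in\mathbb{C}:|z|<1\}$. A family $(\phi_t)_{t\ge 0}$ of holomorphic maps $\phi_t:\mathbb{D}\to\mathbb{D}$ is a semigroup if (a) $\phi_0$ is the identity; (b) $\phi_{t+s}=\phi_t\circ\phi_s$ for all $t,s\ge 0$; (c) $\lim_{t\to s}\phi_t(z)=\phi_s(z)$ for every $s\ge 0$ and $z\in\mathbb{D}$. It is non-elliptic if for every $t>0$ the map $\phi_t$ has no fixed points in $\mathbb{D}$. In that case there is a unique point $\tau\in\partial\mathbb{D}$, the Denjoy-Wolff point, such that $\lim_{t\to\infty}\phi_t(z)=\tau$ for every $z\in\mathbb{D}$. The hyperbolic distance $\rho_{\mathbb{D}}$ is the distance induced by the metric $|dz|/(1-|z|^2)$, i.e. $\rho_{\mathbb{D}}(z,w)=\frac12\log\frac{1+|T(z,w)|}{1-|T(z,w)|}$ with $T(z,w)=\frac{z-w}{1-z\overline{w}}$. The diameter $(-\tau,\tau)=\{r\tau: -1<r<1\}$ is a hyperbolic geodesic. For $t\ge0$, $\pi(\phi_t(0))$ denotes the (unique) point of $(-\tau,\tau)$ at least hyperbolic distance from $\phi_t(0)$. The orthogonal speed is $v^o(t)=\rho_{\mathbb{D}}(0,\pi(\phi_t(0)))$, $t\ge 0$. "Strictly increasing" means $v^o(s)<v^o(t)$ whenever $s<t$.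 *)

theory Defs
  imports "HOL-Complex_Analysis.Complex_Analysis"
begin

text \<open>
  The open unit disc is \<open>ball 0 1\<close>. The maps of a family \<open>\<phi>\<close> are total functions on the complex
  plane, indexed by all reals; only the values \<open>\<phi> t z\<close> with \<open>t \<ge> 0\<close> and \<open>z\<close> in the disc matter.
\<close>

definition disc_semigroup :: "(real \<Rightarrow> complex \<Rightarrow> complex) \<Rightarrow> bool" where
  "disc_semigroup \<phi> \<longleftrightarrow>
     (\<forall>t\<ge>0. \<phi> t holomorphic_on ball 0 1 \<and> \<phi> t ` ball 0 1 \<subseteq> ball 0 1) \<and>
     (\<forall>z\<in>ball 0 1. \<phi> 0 z = z) \<and>
     (\<forall>t\<ge>0. \<forall>s\<ge>0. \<forall>z\<in>ball 0 1. \<phi> (t + s) z = \<phi> t (\<phi> s z)) \<and>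
     (\<forall>s\<ge>0. \<forall>z\<in>ball 0 1. ((\<lambda>t. \<phi> t z) \<longlongrightarrow> \<phi> s z) (at s within {0..}))"

definition non_elliptic :: "(real \<Rightarrow> complex \<Rightarrow> complex) \<Rightarrow> bool" where
  "non_elliptic \<phi> \<longleftrightarrow> (\<forall>t>0. \<forall>z\<in>ball 0 1. \<phi> t z \<noteq> z)"

text \<open>
  For a non-elliptic semigroup the point described below exists and is unique by the
  Denjoy-Wolff theorem; otherwise the value may be unspecified.
\<close>

definition denjoy_wolff_point :: "(real \<Rightarrow> complex \<Rightarrow> complex) \<Rightarrow> complex" where
  "denjoy_wolff_point \<phi> =
     (THE \<tau>. \<tau> \<in> sphere 0 1 \<and> (\<forall>z\<in>ball 0 1. ((\<lambda>t. \<phi> t z) \<longlongrightarrow> \<tau>) at_top))"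

text \<open>
  Distance induced by the metric $|dz|/(1-|z|^2)$, so of curvature $-4$; meaningful for points
  of the disc only.
\<close>

definition hyp_dist :: "complex \<Rightarrow> complex \<Rightarrow> real" where
  "hyp_dist z w =
     (let T = (z - w) / (1 - z * cnj w) in 1 / 2 * ln ((1 + cmod T) / (1 - cmod T)))"

definition diameter_to :: "complex \<Rightarrow> complex set" where
  "diameter_to \<tau> = {of_real r * \<tau> | r. -1 < r \<and> r < 1}"

definition hyp_proj :: "complex \<Rightarrow> complex \<Rightarrow> complex" where
  "hyp_proj \<tau> z =
     (THE p. p \<in> diameter_to \<tau> \<and> (\<forall>q\<in>diameter_to \<tau>. hyp_dist z p \<le> hyp_dist z q))"

definition orthogonal_speed :: "(real \<Rightarrow> complex \<Rightarrow> complex) \<Rightarrow> real \<Rightarrow> real" where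
  "orthogonal_speed \<phi> t = hyp_dist 0 (hyp_proj (denjoy_wolff_point \<phi>) (\<phi> t 0))"

end

theory Submission
  imports Defs
begin

text \<open>
  The Cayley map sending \<open>0\<close> to \<open>1\<close> and the Denjoy-Wolff point to \<open>\<infinity>\<close> turns the orbit of \<open>0\<close> into a
  curve \<open>w\<^sub>t\<close> in the right half-plane with \<open>w\<^sub>0 = 1\<close> and \<open>Re w\<^sub>t\<close> nondecreasing, and turns the
  orthogonal speed into \<open>1/2 ln |w\<^sub>t|\<close>. If \<open>h\<close> is the Koenigs function and \<open>g\<close> its inverse,
  then \<open>w\<^sub>t = g (h 1 + t)\<close>, so by the Cauchy-Riemann equations \<open>ln |w\<^sub>t|\<close> is nondecreasing if \<open>Arg g\<close>
  has nonnegative vertical derivative on the ray \<open>h 1 + [0, \<infinity>)\<close>. At a point of the ray with \<open>Arg g > 0\<close>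
  we compare \<open>Arg g\<close> with its mirror image in the ray: on the region between the curve
  \<open>h (0, \<infinity>)\<close>, where \<open>Arg g = 0\<close>, and the ray, reflection in the ray increases \<open>Arg g\<close>, by the
  maximum principle. Where \<open>Arg g < 0\<close> the situation is symmetric, and where \<open>Arg g = 0\<close> the claim
  follows from \<open>Re h' > 0\<close>. Strictness follows from the identity theorem, since the derivative of
  \<open>ln |w\<^sub>t|\<close> is positive at \<open>t = 0\<close>.
\<close>

section \<open>Reflection of a Koenigs domain\<close>

text \<open>The flow never decreases \<open>Re w\<close>, so its velocity \<open>1 / h'\<close> has
  nonnegative real part; hence \<open>Re h' > 0\<close> everywhere unless \<open>h\<close> is affine
  with imaginary slope, a case settled by direct computation. Positivity makes \<open>h\<close>
  injective and orders its values: \<open>Im h\<close> increases along upward vertical lines,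
  \<open>Re h\<close> along the positive real axis. The obstacle is that \<open>h H\<close> may have
  a wild boundary and that mirror images may fall outside it. The comparison is therefore pulled
  back to the half-plane variable \<open>u\<close> and made only where the mirror image of
  \<open>h u\<close> has a preimage \<open>w\<close> in the first quadrant. At the finite edge of
  that set either \<open>w = u\<close>, or \<open>u\<close> is real and \<open>Arg u = 0\<close>, or
  \<open>w\<close> tends to the imaginary axis and \<open>Arg w\<close> to \<open>pi / 2\<close>;
  all three agree with \<open>Arg u \<le> Arg w\<close>. The dangerous edge, \<open>w\<close> real,
  never occurs: this is \<open>mirror_not_real\<close>. Orbits are only assumed continuous in time.
  Integrating them over a short time interval supplies their differentiability, and from it the
  Koenigs function.\<close>

lemma Re_diff_quotient_pos:
  assumes f: "f holomorphic_on S" "open S" "\<And>z. z \<in> S \<Longrightarrow> 0 < Re (deriv f z)"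
    and ab: "closed_segment a b \<subseteq> S" "a \<noteq> b"
  shows "0 < Re ((f b - f a) / (b - a))"
proof -
  \<comment> \<open>Dividing by \<open>b - a\<close> cancels the direction of the segment, so the
    derivative of \<open>k\<close> is \<open>Re f'\<close> itself.\<close>
  define k where "k t = Re (f (a + of_real t * (b - a)) / (b - a))" for t
  have "\<exists>y. (k has_real_derivative y) (at t) \<and> 0 < y" if "0 \<le> t" "t \<le> 1" for t
  proof -
    have S: "a + of_real t * (b - a) \<in> S"
    proof -
      have "a + of_real t * (b - a) \<in> closed_segment a b"
        unfolding in_segment using that
        by (intro exI[of _ t]) (simp add: scaleR_conv_of_real algebra_simps)
      then show ?thesis using ab by blast
    qed
    have "(f has_field_derivative deriv f (a + of_real t * (b - a))) (at (a + of_real t * (b - a)))"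
      using f(1,2) S holomorphic_derivI by blast
    then have "((\<lambda>\<zeta>. f (a + \<zeta> * (b - a)) / (b - a)) has_field_derivative
        deriv f (a + of_real t * (b - a)) * (b - a) / (b - a)) (at (of_real t))"
      by (intro DERIV_cdivide DERIV_chain2[where f=f] ) (auto intro!: derivative_eq_intros)
    then have "((\<lambda>\<zeta>. f (a + \<zeta> * (b - a)) / (b - a)) has_field_derivative
        deriv f (a + of_real t * (b - a))) (at (of_real t))"
      using ab(2) by simp
    from has_vector_derivative_real_field[OF this]
    have "((\<lambda>t. f (a + of_real t * (b - a)) / (b - a)) has_vector_derivative
        deriv f (a + of_real t * (b - a))) (at t)" .
    from bounded_linear.has_vector_derivative[OF bounded_linear_Re this]
    have "(k has_real_derivative Re (deriv f (a + of_real t * (b - a)))) (at t)"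
      by (simp add: k_def[abs_def] has_real_derivative_iff_has_vector_derivative)
    with f(3)[OF S] show ?thesis by blast
  qed
  from DERIV_pos_imp_increasing[OF _ this, of 0 1] have "k 0 < k 1" by simp
  then show ?thesis by (simp add: k_def diff_divide_distrib)
qed

text \<open>Noshiro-Warschawski: convexity makes the segment between any two points available, and
  the difference quotient along it cannot vanish.\<close>

lemma inj_on_Re_deriv_pos:
  assumes "f holomorphic_on S" "open S" "convex S" "\<And>z. z \<in> S \<Longrightarrow> 0 < Re (deriv f z)"
  shows "inj_on f S"
proof (rule inj_onI, rule ccontr)
  fix a b assume "a \<in> S" "b \<in> S" "f a = f b" "a \<noteq> b"
  then have "0 < Re ((f b - f a) / (b - a))"
    using assms by (intro Re_diff_quotient_pos[of f S]) (auto simp: closed_segment_subset)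
  with \<open>f a = f b\<close> show False by simp
qed

section \<open>Koenigs maps of the half-plane and their inverses\<close>

locale koenigs_map =
  fixes h :: "complex \<Rightarrow> complex"
  assumes holomorphic: "h holomorphic_on {w. 0 < Re w}"
    and Re_deriv_pos: "0 < Re w \<Longrightarrow> 0 < Re (deriv h w)"
    and shift: "0 < Re w \<Longrightarrow> 0 \<le> t \<Longrightarrow> h w + of_real t \<in> h ` {w. 0 < Re w}"
begin

abbreviation H where "H \<equiv> {w::complex. 0 < Re w}"
abbreviation \<Omega> where "\<Omega> \<equiv> h ` H"

lemma open_H: "open H" by (rule open_halfspace_Re_gt)
lemma convex_H: "convex H" by (rule convex_halfspace_Re_gt)

lemma inj: "inj_on h H"
  by (rule inj_on_Re_deriv_pos) (auto simp: holomorphic open_H convex_H Re_deriv_pos)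

definition g where "g = the_inv_into H h"

lemma g_h [simp]: "0 < Re w \<Longrightarrow> g (h w) = w"
  unfolding g_def using inj by (simp add: the_inv_into_f_f)

lemma Re_g: "z \<in> \<Omega> \<Longrightarrow> 0 < Re (g z)" and h_g: "z \<in> \<Omega> \<Longrightarrow> h (g z) = z"
  by auto

lemma open_\<Omega>: "open \<Omega>"
  using holomorphic open_H inj by (rule open_mapping_thm3)

lemma g_deriv: "z \<in> \<Omega> \<Longrightarrow> (g has_field_derivative 1 / deriv h (g z)) (at z)"
proof -
  assume z: "z \<in> \<Omega>"
  obtain k where k: "k holomorphic_on \<Omega>" "\<And>w. w \<in> H \<Longrightarrow> deriv h w * deriv k (h w) = 1"
      "\<And>w. w \<in> H \<Longrightarrow> k (h w) = w"
    using holomorphic_has_inverse[OF holomorphic open_H inj] by metis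
  have "(k has_field_derivative deriv k z) (at z)"
    using holomorphic_derivI k(1) open_\<Omega> z by blast
  then have "(g has_field_derivative deriv k z) (at z)"
    by (rule has_field_derivative_transform_within_open[OF _ open_\<Omega> z]) (use k in auto)
  moreover have "deriv k z = 1 / deriv h (g z)"
    using k(2)[of "g z"] z Re_deriv_pos[of "g z"] by (auto simp: eq_divide_eq mult.commute)
  ultimately show ?thesis by simp
qed

lemma g_holomorphic: "g holomorphic_on \<Omega>"
  using g_deriv field_differentiable_at_within field_differentiable_def holomorphic_on_def by metis

lemma Re_inverse_pos: "0 < Re w \<Longrightarrow> 0 < Re (1 / w)"
  by (simp add: Re_divide sum_power2_gt_zero_iff)

lemma Re_deriv_g_pos: "z \<in> \<Omega> \<Longrightarrow> 0 < Re (deriv g z)"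
  using DERIV_imp_deriv[OF g_deriv] Re_inverse_pos[OF Re_deriv_pos[OF Re_g]] by simp

lemma h_diff: "0 < Re a \<Longrightarrow> 0 < Re b \<Longrightarrow> a \<noteq> b \<Longrightarrow> 0 < Re ((h b - h a) / (b - a))"
  using Re_diff_quotient_pos[OF holomorphic open_H, of a b] Re_deriv_pos convex_H
  by (auto simp: closed_segment_subset)

lemma g_diff: "closed_segment a b \<subseteq> \<Omega> \<Longrightarrow> a \<noteq> b \<Longrightarrow> 0 < Re ((g b - g a) / (b - a))"
  using Re_diff_quotient_pos[OF g_holomorphic open_\<Omega>, of a b] Re_deriv_g_pos by blast

text \<open>A vertical step is \<open>\<i>\<close> times a positive number, and dividing by
  \<open>\<i>\<close> turns the positive real part of the difference quotient into an imaginary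
  one.\<close>

lemma Im_h_less: "0 < Re a \<Longrightarrow> Re a = Re b \<Longrightarrow> Im a < Im b \<Longrightarrow> Im (h a) < Im (h b)"
proof -
  assume *: "0 < Re a" "Re a = Re b" "Im a < Im b"
  then have "b - a = \<i> * of_real (Im b - Im a)" by (simp add: complex_eq_iff)
  with h_diff[of a b] * have "0 < Re ((h b - h a) / (\<i> * of_real (Im b - Im a)))"
    by auto
  also have "(h b - h a) / (\<i> * of_real (Im b - Im a)) = - \<i> * (h b - h a) / of_real (Im b - Im a)"
    by (simp add: divide_simps)
  finally show ?thesis using *
    by (simp only: Re_divide_of_real) (auto simp: zero_less_divide_iff divide_less_0_iff)
qed

lemma Re_h_less: "0 < r \<Longrightarrow> r < s \<Longrightarrow> Re (h (of_real r)) < Re (h (of_real s))"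
proof -
  assume *: "0 < r" "r < s"
  with h_diff[of "of_real r" "of_real s"]
  have "0 < Re ((h (of_real s) - h (of_real r)) / of_real (s - r))" by auto
  then show ?thesis using * by (simp only: Re_divide_of_real) (simp add: zero_less_divide_iff)
qed

lemma shift': "z \<in> \<Omega> \<Longrightarrow> 0 \<le> t \<Longrightarrow> z + of_real t \<in> \<Omega>"
  using shift by auto

lemma Re_g_less: "z \<in> \<Omega> \<Longrightarrow> 0 < t \<Longrightarrow> Re (g z) < Re (g (z + of_real t))"
proof -
  assume z: "z \<in> \<Omega>" and t: "0 < t"
  have "closed_segment z (z + of_real t) \<subseteq> \<Omega>"
  proof
    fix x assume "x \<in> closed_segment z (z + of_real t)"
    then obtain u where u: "0 \<le> u" "x = (1 - u) *\<^sub>R z + u *\<^sub>R (z + of_real t)"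
      unfolding closed_segment_def by auto
    then have "x = z + of_real (u * t)" by (simp add: scaleR_conv_of_real algebra_simps)
    with shift'[OF z, of "u * t"] u t show "x \<in> \<Omega>" by simp
  qed
  from g_diff[OF this] t have "0 < Re ((g (z + of_real t) - g z) / of_real t)" by simp
  then show ?thesis using t by (simp only: Re_divide_of_real) (simp add: zero_less_divide_iff)
qed

lemma continuous_Im_h_real: "0 < a \<Longrightarrow> continuous_on {a..b} (\<lambda>r. Im (h (of_real r)))"
  by (intro continuous_intros continuous_on_compose2[OF holomorphic_on_imp_continuous_on[OF holomorphic]])
     auto

text \<open>
  The curve \<open>h (0, \<infinity>)\<close> is the graph of a function of the abscissa and \<open>\<Omega>\<close> contains everything to the
  right of it. If \<open>h r\<close> were the mirror image of \<open>h u\<close>, then the whole vertical segment between them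
  would be to the right of the curve, but \<open>Im g\<close> increases along vertical segments.
\<close>

lemma mirror_not_real:
  assumes u: "1 < Re u" "0 < Im u" "Im (h u) < Im (h 1)" and r: "0 < r"
  shows "h (of_real r) \<noteq> cnj (h u) + 2 * \<i> * of_real (Im (h 1))"
proof
  assume eq: "h (of_real r) = cnj (h u) + 2 * \<i> * of_real (Im (h 1))"
  define y where "y = Im (h 1)"
  define c where "c = Re u"
  have Re_eq: "Re (h (of_real r)) = Re (h u)" and Im_eq: "Im (h (of_real r)) = 2 * y - Im (h u)"
    using eq by (simp_all add: y_def)
  have c: "1 < c" using u c_def by simp
  have "Im (h (of_real c)) < Im (h u)"
    using u by (intro Im_h_less) (auto simp: c_def)
  \<comment> \<open>Between \<open>1\<close> and \<open>c\<close> the height of the curve falls from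
    above that of \<open>h u\<close> to below it; \<open>r'\<close> is a crossing.\<close>
  with IVT2'[of "\<lambda>r. Im (h (of_real r))" c "Im (h u)" 1] continuous_Im_h_real[of 1 c] c u
  obtain r' where r': "1 \<le> r'" "r' \<le> c" "Im (h (of_real r')) = Im (h u)"
    by auto
  define s where "s = Re (h u) - Re (h (of_real r'))"
  have hu: "h u = h (of_real r') + of_real s"
    using r' by (simp add: complex_eq_iff s_def)
  \<comment> \<open>If \<open>h u\<close> lay to the left of \<open>h r'\<close>, moving right from
    it would increase \<open>Re g\<close> and give \<open>Re u < r' \<le> c = Re u\<close>.\<close>
  have "0 \<le> s"
  proof (rule ccontr)
    assume "\<not> 0 \<le> s"
    then have "Re (g (h u)) < Re (g (h u + of_real (- s)))"
      using u by (intro Re_g_less) auto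
    moreover have "h u + of_real (- s) = h (of_real r')" using hu by simp
    ultimately have "Re u < r'" using u r' by simp
    then show False using r' c_def by simp
  qed
  then have rr': "r' \<le> r"
    using Re_h_less[of r r'] r s_def Re_eq by linarith
  have seg: "closed_segment (h u) (h (of_real r)) \<subseteq> \<Omega>"
  proof
    fix z assume "z \<in> closed_segment (h u) (h (of_real r))"
    then have z: "Re z = Re (h u)" "Im (h u) \<le> Im z" "Im z \<le> Im (h (of_real r))"
      using Re_eq Im_eq u y_def
      by (auto simp: closed_segment_same_Re closed_segment_eq_real_ivl split: if_splits)
    with IVT'[of "\<lambda>r. Im (h (of_real r))" r' "Im z" r] continuous_Im_h_real[of r' r] rr' r'
    obtain q where q: "r' \<le> q" "q \<le> r" "Im (h (of_real q)) = Im z"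
      by auto
    have "Re (h (of_real q)) \<le> Re (h (of_real r))"
      using Re_h_less[of q r] q r' by (cases "q = r") auto
    with z Re_eq have "z = h (of_real q) + of_real (Re z - Re (h (of_real q)))" 
      and "0 \<le> Re z - Re (h (of_real q))"
      using q by (simp_all add: complex_eq_iff)
    then show "z \<in> \<Omega>"
      using shift[of "of_real q" "Re z - Re (h (of_real q))"] q r' by simp
  qed
  have d: "h (of_real r) - h u = \<i> * of_real (2 * (y - Im (h u)))"
    using Re_eq Im_eq by (simp add: complex_eq_iff)
  then have "h u \<noteq> h (of_real r)" using u y_def by (auto simp: complex_eq_iff)
  from g_diff[OF seg this] d u r
  have "0 < Re ((of_real r - u) / (\<i> * of_real (2 * (y - Im (h u)))))" by simp
  also have "(of_real r - u) / (\<i> * of_real (2 * (y - Im (h u)))) =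
      - \<i> * (of_real r - u) / of_real (2 * (y - Im (h u)))"
    by (simp add: divide_simps)
  finally have "0 < Im (of_real r - u) / (2 * (y - Im (h u)))"
    by (simp only: Re_divide_of_real) simp
  then show False using u y_def by (simp add: divide_less_0_iff)
qed

section \<open>Reflection in the ray and comparison of arguments\<close>

definition mirror where "mirror z = cnj z + 2 * \<i> * of_real (Im (h 1))"

text \<open>The bound \<open>1 < Re u\<close> holds at the preimages of all points of the ray except
  its origin, by \<open>Re_g_less\<close>. It keeps \<open>u\<close> away from \<open>0\<close>,
  which is why \<open>barrier\<close> below has no term in \<open>1 / u\<close>.\<close>

definition reflectable where
  "reflectable = {u. 1 < Re u \<and> 0 < Im u \<and> Im (h u) < Im (h 1) \<and> mirror (h u) \<in> \<Omega> \<and>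
     0 < Im (g (mirror (h u)))}"

text \<open>\<open>mirror\<close> is antiholomorphic; the outer conjugation makes the composition
  holomorphic in \<open>u\<close>.\<close>

definition partner where "partner u = cnj (g (mirror (h u)))"

text \<open>
  The real part of \<open>barrier \<epsilon> u\<close> is \<open>Arg w - Arg u\<close>, where \<open>w = g (mirror (h u))\<close>, plus \<open>\<epsilon>\<close> times a term
  that is at least \<open>|w| + 1/|w| + |u|\<close> in the first quadrant. The latter takes care of the boundary
  points \<open>0\<close> and \<open>\<infinity>\<close>, where the arguments have no limit.
\<close>

definition barrier where
  "barrier \<epsilon> u = \<i> * (Ln (partner u) + Ln u) +
     of_real \<epsilon> * ((1 + \<i>) * partner u + (1 - \<i>) / partner u + (1 - \<i>) * u)"

lemma cnj_mirror: "cnj (mirror z) = z - 2 * \<i> * of_real (Im (h 1))"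
  by (simp add: mirror_def)

lemma partner_holomorphic: "partner holomorphic_on H \<inter> (\<lambda>u. mirror (h u)) -` \<Omega>"
proof -
  have op: "open (cnj ` \<Omega>)"
    unfolding image_cnj_conv_vimage_cnj using open_\<Omega> by (intro open_vimage) (auto intro: continuous_intros)
  have "cnj ` cnj ` \<Omega> = \<Omega>" by (auto simp: image_image)
  then have "(cnj \<circ> g \<circ> cnj) holomorphic_on cnj ` \<Omega>"
    using g_holomorphic by (intro holomorphic_on_compose_cnj_cnj op) auto
  then have "(cnj \<circ> g \<circ> cnj) \<circ> (\<lambda>u. h u - 2 * \<i> * of_real (Im (h 1))) holomorphic_on
      H \<inter> (\<lambda>u. mirror (h u)) -` \<Omega>"
  proof (rule holomorphic_on_compose_gen[rotated])
    show "(\<lambda>u. h u - 2 * \<i> * of_real (Im (h 1))) ` (H \<inter> (\<lambda>u. mirror (h u)) -` \<Omega>) \<subseteq> cnj ` \<Omega>"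
    proof safe
      fix u x assume "mirror (h u) = h x" "0 < Re x" 
      then have "h u - 2 * \<i> * of_real (Im (h 1)) = cnj (h x)"
        using cnj_mirror[of "h u"] by simp
      then show "h u - 2 * \<i> * of_real (Im (h 1)) \<in> cnj ` \<Omega>"
        using \<open>0 < Re x\<close> by auto
    qed
    show "(\<lambda>u. h u - 2 * \<i> * of_real (Im (h 1))) holomorphic_on H \<inter> (\<lambda>u. mirror (h u)) -` \<Omega>"
      by (intro holomorphic_intros holomorphic_on_subset[OF holomorphic]) auto
  qed
  moreover have "(cnj \<circ> g \<circ> cnj) \<circ> (\<lambda>u. h u - 2 * \<i> * of_real (Im (h 1))) = partner"
    by (simp add: fun_eq_iff partner_def mirror_def)
  ultimately show ?thesis by simp
qed

lemma continuous_h: "continuous_on H h"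
  using holomorphic holomorphic_on_imp_continuous_on by blast

lemma open_preimage_mirror: "open (H \<inter> (\<lambda>u. mirror (h u)) -` \<Omega>)"
  unfolding mirror_def
  by (intro continuous_open_preimage open_H open_\<Omega> continuous_intros continuous_h)

lemma reflectable_subset: "reflectable \<subseteq> H \<inter> (\<lambda>u. mirror (h u)) -` \<Omega>"
  by (auto simp: reflectable_def)

lemma open_reflectable: "open reflectable"
proof -
  let ?A = "H \<inter> (\<lambda>u. mirror (h u)) -` \<Omega>"
  have "open (?A \<inter> partner -` {z. Im z < 0})"
    using holomorphic_on_imp_continuous_on[OF partner_holomorphic] open_preimage_mirror
      open_halfspace_Im_lt by (rule continuous_open_preimage)
  moreover have "open (H \<inter> h -` {z. Im z < Im (h 1)})"
    using continuous_h open_H open_halfspace_Im_lt by (rule continuous_open_preimage)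
  moreover have "reflectable = (?A \<inter> partner -` {z. Im z < 0}) \<inter> (H \<inter> h -` {z. Im z < Im (h 1)}) \<inter>
      {z. 1 < Re z} \<inter> {z. 0 < Im z}"
    by (auto simp: reflectable_def partner_def)
  ultimately show ?thesis
    by (simp add: open_Int open_halfspace_Re_gt open_halfspace_Im_gt)
qed

lemma Re_partner: "u \<in> reflectable \<Longrightarrow> 0 < Re (partner u)" and Im_partner: "u \<in> reflectable \<Longrightarrow> Im (partner u) < 0"
  using Re_g by (auto simp: reflectable_def partner_def)

lemma barrier_holomorphic: "barrier \<epsilon> holomorphic_on reflectable"
proof -
  have partner: "partner holomorphic_on reflectable"
    using partner_holomorphic reflectable_subset by (rule holomorphic_on_subset)
  have "partner u \<notin> \<real>\<^sub>\<le>\<^sub>0" "u \<notin> \<real>\<^sub>\<le>\<^sub>0" "partner u \<noteq> 0" if "u \<in> reflectable" for u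
    using Re_partner[OF that] that by (auto simp: reflectable_def complex_nonpos_Reals_iff)
  then show ?thesis
    unfolding barrier_def[abs_def] by (intro holomorphic_intros partner) auto
qed

lemma norm_le_Re_Im: "0 \<le> Re z \<Longrightarrow> 0 \<le> Im z \<Longrightarrow> cmod z \<le> Re z + Im z"
  using cmod_le[of z] by simp

text \<open>For \<open>w = a + \<i> * b\<close> in the first quadrant the factors
  \<open>1 + \<i>\<close> and \<open>1 - \<i>\<close> produce the real part \<open>a + b\<close>,
  divided by \<open>|w|^2\<close> in the reciprocal term, and \<open>a + b\<close> dominates
  \<open>|w|\<close>.\<close>

lemma Re_barrier_ge:
  assumes u: "u \<in> reflectable" and \<epsilon>: "0 < \<epsilon>"
  defines "w \<equiv> g (mirror (h u))"
  shows "Im (Ln w) - Im (Ln u) + \<epsilon> * (cmod w + 1 / cmod w + cmod u) \<le> Re (barrier \<epsilon> u)"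
proof -
  have partner: "partner u = cnj w" by (simp add: partner_def w_def)
  have w: "0 < Re w" "0 < Im w" using Re_partner[OF u] Im_partner[OF u] partner by auto
  have wn: "w \<notin> \<real>\<^sub>\<le>\<^sub>0" using w by (auto simp: complex_nonpos_Reals_iff)
  have uu: "1 < Re u" "0 < Im u" using u by (auto simp: reflectable_def)
  have w1: "cmod w \<le> Re w + Im w" "cmod u \<le> Re u + Im u" using w uu by (auto intro: norm_le_Re_Im)
  have inv: "1 / cmod w \<le> (Re w + Im w) / (cmod w)\<^sup>2"
  proof -
    have "0 < cmod w" using w by auto
    then have "1 / cmod w = cmod w / (cmod w)\<^sup>2" by (simp add: power2_eq_square)
    also have "\<dots> \<le> (Re w + Im w) / (cmod w)\<^sup>2" using w1 by (intro divide_right_mono) auto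
    finally show ?thesis .
  qed
  have "Re ((1 - \<i>) / partner u) = (Re w + Im w) / (cmod w)\<^sup>2"
    by (simp add: partner Re_divide cmod_power2)
  then have "Re (barrier \<epsilon> u) = Im (Ln w) - Im (Ln u) +
      \<epsilon> * ((Re w + Im w) + (Re w + Im w) / (cmod w)\<^sup>2 + (Re u + Im u))"
    using cnj_Ln[OF wn, symmetric]
    by (simp add: barrier_def partner)
  moreover have "\<epsilon> * (cmod w + 1 / cmod w + cmod u) \<le> 
      \<epsilon> * ((Re w + Im w) + (Re w + Im w) / (cmod w)\<^sup>2 + (Re u + Im u))"
    using w1 inv \<epsilon> by (intro mult_left_mono add_mono) auto
  ultimately show ?thesis by simp
qed

text \<open>Each way of lying on the edge is excluded: \<open>u\<close> real and
  \<open>w = u\<close> by the strict inequality of arguments, \<open>Re u = 1\<close> because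
  \<open>Im h\<close> increases upwards from \<open>h 1\<close>, and \<open>w\<close> real by
  \<open>mirror_not_real\<close>.\<close>

lemma reflectable_limit:
  assumes u: "1 \<le> Re u" "0 \<le> Im u" "Im (h u) \<le> Im (h 1)"
    and w: "0 < Re w" "0 \<le> Im w" "h w = mirror (h u)"
    and less: "Im (Ln w) < Im (Ln u)"
  shows "u \<in> reflectable"
proof -
  have nz: "w \<noteq> 0" "u \<noteq> 0" using u w by auto
  have "Im u \<noteq> 0"
  proof
    assume "Im u = 0"
    then have "Im (Ln u) = 0" using u nz Im_Ln_eq_0 by auto
    with less Im_Ln_pos_le[OF nz(1)] w show False by auto
  qed
  then have Im_u: "0 < Im u" using u by simp
  have "Im (h u) \<noteq> Im (h 1)"
  proof
    assume "Im (h u) = Im (h 1)"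
    then have "mirror (h u) = h u" by (simp add: mirror_def complex_eq_iff)
    then have "w = u" using w u inj by (auto simp: inj_on_def)
    with less show False by simp
  qed
  then have Im_hu: "Im (h u) < Im (h 1)" using u by simp
  have "Re u \<noteq> 1" using Im_h_less[of 1 u] Im_u Im_hu by auto
  then have Re_u: "1 < Re u" using u by simp
  have "Im w \<noteq> 0"
  proof
    assume "Im w = 0"
    then have "w = of_real (Re w)" by (simp add: complex_eq_iff)
    with mirror_not_real[OF Re_u Im_u Im_hu w(1)] w(3) show False
      unfolding mirror_def by simp
  qed
  moreover have "g (mirror (h u)) = w" using w by (metis g_h)
  ultimately show ?thesis
    using Re_u Im_u Im_hu w by (auto simp: reflectable_def image_iff intro!: exI[of _ w])
qed

text \<open>No sequence in the sublevel set can escape to the edge of \<open>reflectable\<close>.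
  The \<open>\<epsilon>\<close> term bounds \<open>u\<close> and \<open>w\<close> and keeps
  \<open>w\<close> away from \<open>0\<close>; the margin \<open>\<delta>\<close> survives in the
  limit and provides the strict inequality that \<open>reflectable_limit\<close> asks for.\<close>

lemma compact_sublevel:
  assumes \<epsilon>: "0 < \<epsilon>" and \<delta>: "0 < \<delta>"
  shows "compact {u \<in> reflectable. Re (barrier \<epsilon> u) \<le> - \<delta>}" (is "compact ?S")
  unfolding compact_def
proof (intro allI impI)
  fix f :: "nat \<Rightarrow> complex" assume f: "\<forall>n. f n \<in> ?S"
  define w where "w n = g (mirror (h (f n)))" for n
  \<comment> \<open>Both arguments lie between \<open>0\<close> and \<open>pi / 2\<close>, so their
    difference is at least \<open>- pi / 2\<close>, and \<open>\<epsilon>\<close> times the weight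
    is at most \<open>pi / 2\<close>.\<close>
  define C where "C = pi / (2 * \<epsilon>)"
  have C: "0 < C" using \<epsilon> by (simp add: C_def)
  have fn: "1 < Re (f n)" "0 < Im (f n)" "Im (h (f n)) < Im (h 1)" "mirror (h (f n)) \<in> \<Omega>" for n
    using f by (auto simp: reflectable_def)
  have wn: "0 < Re (w n)" "0 < Im (w n)" "h (w n) = mirror (h (f n))" for n
    using f h_g Re_g by (auto simp: reflectable_def w_def)
  have bar: "Im (Ln (w n)) - Im (Ln (f n)) + \<epsilon> * (cmod (w n) + 1 / cmod (w n) + cmod (f n)) \<le> - \<delta>" for n
  proof -
    have "f n \<in> reflectable" "Re (barrier \<epsilon> (f n)) \<le> - \<delta>" using f by auto
    then show ?thesis using Re_barrier_ge[of "f n" \<epsilon>] \<epsilon> unfolding w_def by linarith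
  qed
  have Ln_le: "Im (Ln (w n)) - Im (Ln (f n)) \<le> - \<delta>" for n
  proof -
    have "0 \<le> \<epsilon> * (cmod (w n) + 1 / cmod (w n) + cmod (f n))" using \<epsilon> by simp
    with bar[of n] show ?thesis by linarith
  qed
  have bd: "cmod (w n) \<le> C" "1 / cmod (w n) \<le> C" "cmod (f n) \<le> C" for n
  proof -
    have "0 < Im (Ln (w n))" using Im_Ln_pos_lt_imp wn by blast
    moreover have "Im (Ln (f n)) < pi / 2" using Re_Ln_pos_lt_imp[of "f n"] fn[of n] by auto
    ultimately have "\<epsilon> * (cmod (w n) + 1 / cmod (w n) + cmod (f n)) \<le> pi / 2"
      using bar[of n] \<delta> by linarith
    then have *: "cmod (w n) + 1 / cmod (w n) + cmod (f n) \<le> C"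
      using \<epsilon> by (simp add: C_def field_simps)
    have "0 \<le> 1 / cmod (w n)" by simp
    with * show "cmod (w n) \<le> C" "1 / cmod (w n) \<le> C" "cmod (f n) \<le> C"
      using norm_ge_zero[of "w n"] norm_ge_zero[of "f n"] by linarith+
  qed
  have K: "compact (cball (0::complex) C \<times> cball (0::complex) C)"
    by (intro compact_Times compact_cball)
  have "\<forall>n. (f n, w n) \<in> cball 0 C \<times> cball 0 C" using bd by auto
  then obtain l r where r: "strict_mono r" and l: "((\<lambda>n. (f n, w n)) \<circ> r) \<longlonglongrightarrow> l"
    using compact_def[THEN iffD1, OF K, THEN spec, of "\<lambda>n. (f n, w n)"] by blast
  define u where "u = fst l"
  define v where "v = snd l"
  have fl: "(\<lambda>n. f (r n)) \<longlonglongrightarrow> u" using tendsto_fst[OF l] by (simp add: o_def u_def)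
  have wl: "(\<lambda>n. w (r n)) \<longlonglongrightarrow> v" using tendsto_snd[OF l] by (simp add: o_def v_def)
  have u: "1 \<le> Re u" "0 \<le> Im u"
    using LIMSEQ_le_const[OF tendsto_Re[OF fl], of 1] LIMSEQ_le_const[OF tendsto_Im[OF fl], of 0]
      fn less_imp_le by blast+
  have v: "0 \<le> Re v" "0 \<le> Im v"
    using LIMSEQ_le_const[OF tendsto_Re[OF wl], of 0] LIMSEQ_le_const[OF tendsto_Im[OF wl], of 0]
      wn less_imp_le by blast+
  have "1 / C \<le> cmod (w n)" for n
  proof -
    have "0 < cmod (w n)" using wn[of n] by auto
    then show ?thesis using bd(2)[of n] C by (simp add: field_simps)
  qed
  then have "1 / C \<le> cmod v" using LIMSEQ_le_const[OF tendsto_norm[OF wl], of "1 / C"] by blast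
  then have v0: "v \<noteq> 0" using C by auto
  have hl: "(\<lambda>n. h (f (r n))) \<longlonglongrightarrow> h u"
    using u fn by (intro continuous_on_tendsto_compose[OF continuous_h fl]) 
       (auto intro!: always_eventually intro: order.strict_trans[OF zero_less_one])
  have hu: "Im (h u) \<le> Im (h 1)"
    using LIMSEQ_le_const2[OF tendsto_Im[OF hl], of "Im (h 1)"] fn less_imp_le by blast
  have nonpos: "u \<notin> \<real>\<^sub>\<le>\<^sub>0" "v \<notin> \<real>\<^sub>\<le>\<^sub>0"
    using u v v0 by (auto simp: complex_nonpos_Reals_iff complex_eq_iff)
  have "(\<lambda>n. Im (Ln (w (r n))) - Im (Ln (f (r n)))) \<longlonglongrightarrow> Im (Ln v) - Im (Ln u)"
    using nonpos fl wl by (intro tendsto_intros)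
  then have Ln_uv: "Im (Ln v) - Im (Ln u) \<le> - \<delta>"
    using LIMSEQ_le_const2 Ln_le by blast
  \<comment> \<open>This is where the mirror image would reach the boundary of
    \<open>\<Omega>\<close>: then \<open>Arg v = pi / 2\<close> exceeds \<open>Arg u\<close>,
    against the margin.\<close>
  have "Re v \<noteq> 0"
  proof
    assume "Re v = 0"
    then have "Im (Ln v) = pi / 2"
      using Im_Ln_eq_pi_half(1)[OF v0] v v0 by (auto simp: complex_eq_iff)
    moreover have "Im (Ln u) < pi / 2" using Re_Ln_pos_lt_imp[of u] u by auto
    ultimately show False using Ln_uv \<delta> by linarith
  qed
  then have Re_v: "0 < Re v" using v by simp
  have "(\<lambda>n. h (w (r n))) \<longlonglongrightarrow> h v"
    using Re_v wn by (intro continuous_on_tendsto_compose[OF continuous_h wl]) auto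
  moreover have "(\<lambda>n. h (w (r n))) \<longlonglongrightarrow> mirror (h u)"
    unfolding wn mirror_def by (intro tendsto_intros hl)
  ultimately have "h v = mirror (h u)" by (rule LIMSEQ_unique)
  then have u_in: "u \<in> reflectable"
    using Ln_uv \<delta> by (intro reflectable_limit[OF u hu Re_v v(2)]) auto
  have "(\<lambda>n. Re (barrier \<epsilon> (f (r n)))) \<longlonglongrightarrow> Re (barrier \<epsilon> u)"
    using f u_in
    by (intro tendsto_Re continuous_on_tendsto_compose[OF holomorphic_on_imp_continuous_on[OF barrier_holomorphic] fl])
       auto
  then have "Re (barrier \<epsilon> u) \<le> - \<delta>" using f LIMSEQ_le_const2[of _ _ "- \<delta>"] by blast
  with u_in r fl show "\<exists>l\<in>?S. \<exists>r. strict_mono r \<and> (f \<circ> r) \<longlonglongrightarrow> l"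
    by (auto simp: o_def intro!: bexI[of _ u] exI[of _ r])
qed

lemma Re_barrier_nonneg:
  assumes \<epsilon>: "0 < \<epsilon>" and u: "u \<in> reflectable"
  shows "0 \<le> Re (barrier \<epsilon> u)"
proof (rule ccontr)
  assume neg: "\<not> 0 \<le> Re (barrier \<epsilon> u)"
  \<comment> \<open>Half of the negative value leaves room for a contradiction:
    \<open>exp (- barrier \<epsilon> u)\<close> has modulus \<open>exp (2 * \<delta>)\<close>, but
    the modulus is at most \<open>exp \<delta>\<close> on the frontier of the sublevel set.\<close>
  define \<delta> where "\<delta> = - Re (barrier \<epsilon> u) / 2"
  have \<delta>: "0 < \<delta>" using neg by (simp add: \<delta>_def)
  define S where "S = {u \<in> reflectable. Re (barrier \<epsilon> u) \<le> - \<delta>}"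
  have S: "compact S" unfolding S_def by (rule compact_sublevel[OF \<epsilon> \<delta>])
  have sub: "S \<subseteq> reflectable" by (auto simp: S_def)
  have hol: "(\<lambda>u. exp (- barrier \<epsilon> u)) holomorphic_on reflectable"
    by (intro holomorphic_intros barrier_holomorphic)
  have "cmod (exp (- barrier \<epsilon> u)) \<le> exp \<delta>"
  proof (rule maximum_modulus_frontier[where f = "\<lambda>u. exp (- barrier \<epsilon> u)" and S = S])
    show "(\<lambda>u. exp (- barrier \<epsilon> u)) holomorphic_on interior S"
      using hol sub interior_subset by (meson holomorphic_on_subset order_trans)
    show "continuous_on (closure S) (\<lambda>u. exp (- barrier \<epsilon> u))"
      using hol sub S by (metis closure_closed compact_imp_closed holomorphic_on_imp_continuous_on
          holomorphic_on_subset)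
    show "bounded S" using S compact_imp_bounded by blast
    show "u \<in> S" using u neg by (simp add: S_def \<delta>_def)
    fix z assume z: "z \<in> frontier S"
    then have zS: "z \<in> S" using S by (metis compact_imp_closed frontier_subset_closed subsetD)
    have "\<not> Re (barrier \<epsilon> z) < - \<delta>"
    proof
      assume less: "Re (barrier \<epsilon> z) < - \<delta>"
      have "open (reflectable \<inter> barrier \<epsilon> -` {z. Re z < - \<delta>})"
        using holomorphic_on_imp_continuous_on[OF barrier_holomorphic] open_reflectable
          open_halfspace_Re_lt by (rule continuous_open_preimage)
      then have "z \<in> interior S"
        using less zS sub by (intro interiorI[of "reflectable \<inter> barrier \<epsilon> -` {z. Re z < - \<delta>}"])
          (auto simp: S_def)
      with z show False by (simp add: frontier_def)
    qed
    then show "cmod (exp (- barrier \<epsilon> z)) \<le> exp \<delta>" by simp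
  qed
  then show False using \<delta> by (simp add: \<delta>_def)
qed

text \<open>For fixed \<open>u\<close> the real part of the barrier is affine in
  \<open>\<epsilon>\<close>, so the auxiliary weight disappears as \<open>\<epsilon>\<close> tends
  to \<open>0\<close>.\<close>

lemma Im_Ln_mirror_ge:
  assumes u: "u \<in> reflectable"
  shows "Im (Ln u) \<le> Im (Ln (g (mirror (h u))))"
proof -
  define a where "a = Re (\<i> * (Ln (partner u) + Ln u))"
  define b where "b = Re ((1 + \<i>) * partner u + (1 - \<i>) / partner u + (1 - \<i>) * u)"
  have "barrier \<epsilon> u = \<i> * (Ln (partner u) + Ln u) + \<epsilon> *\<^sub>R ((1 + \<i>) * partner u + (1 - \<i>) / partner u + (1 - \<i>) * u)" for \<epsilon>
    by (simp add: barrier_def scaleR_conv_of_real)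
  then have "Re (barrier \<epsilon> u) = a + \<epsilon> * b" for \<epsilon>
    by (simp only: a_def b_def plus_complex.sel scaleR_complex.sel)
  then have "0 \<le> a + \<epsilon> * b" if "0 < \<epsilon>" for \<epsilon>
    using Re_barrier_nonneg[OF that u] by simp
  then have "\<forall>\<^sub>F \<epsilon> in at_right 0. 0 \<le> a + \<epsilon> * b"
    by (rule eventually_mono[OF eventually_at_right_less])
  moreover have "((\<lambda>\<epsilon>. a + \<epsilon> * b) \<longlongrightarrow> a + 0 * b) (at_right 0)"
    by (intro tendsto_intros)
  ultimately have "0 \<le> a + 0 * b"
    using tendsto_lowerbound trivial_limit_at_right_real by blast
  then have "0 \<le> a" by simp
  moreover have "g (mirror (h u)) \<notin> \<real>\<^sub>\<le>\<^sub>0"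
    using Re_partner[OF u] by (auto simp: partner_def complex_nonpos_Reals_iff)
  from cnj_Ln[OF this] have "Ln (partner u) = cnj (Ln (g (mirror (h u))))" by (simp add: partner_def)
  ultimately show ?thesis by (simp add: a_def)
qed

section \<open>Vertical derivative of the argument and growth of the modulus\<close>

lemma Re_log_deriv_nonneg_upper:
  assumes u: "1 < Re u" "0 < Im u" "Im (h u) = Im (h 1)"
  shows "0 \<le> Re (1 / (deriv h u * u))"
proof (rule ccontr)
  assume neg: "\<not> 0 \<le> Re (1 / (deriv h u * u))"
  have z: "h u \<in> \<Omega>" using u by auto
  have cont_g: "continuous_on \<Omega> g" using g_holomorphic holomorphic_on_imp_continuous_on by blast
  have "open (\<Omega> \<inter> g -` ({z. 1 < Re z} \<inter> {z. 0 < Im z}))"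
    by (intro continuous_open_preimage cont_g open_\<Omega> open_Int open_halfspace_Re_gt open_halfspace_Im_gt)
  moreover have "h u \<in> \<Omega> \<inter> g -` ({z. 1 < Re z} \<inter> {z. 0 < Im z})" using u z by auto
  ultimately obtain e where e: "0 < e" "ball (h u) e \<subseteq> \<Omega> \<inter> g -` ({z. 1 < Re z} \<inter> {z. 0 < Im z})"
    using open_contains_ball by meson
  \<comment> \<open>The points at signed heights \<open>\<eta>\<close> and \<open>- \<eta>\<close>
    over the ray are mirror images of each other. The odd difference of \<open>\<theta>\<close> is
    thus nonnegative for small \<open>\<eta> > 0\<close>, and its derivative at \<open>0\<close> is
    twice that of \<open>\<theta>\<close>.\<close>
  define \<theta> where "\<theta> \<eta> = Im (Ln (g (h u + \<i> * of_real \<eta>)))" for \<eta>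
  have mono: "\<theta> (- \<eta>) \<le> \<theta> \<eta>" if \<eta>: "0 < \<eta>" "\<eta> < e" for \<eta>
  proof -
    have "h u + \<i> * of_real \<eta> \<in> ball (h u) e" "h u - \<i> * of_real \<eta> \<in> ball (h u) e"
      using \<eta> by (auto simp: dist_norm norm_mult)
    then have in_ball: "h u + \<i> * of_real \<eta> \<in> \<Omega> \<inter> g -` ({z. 1 < Re z} \<inter> {z. 0 < Im z})"
      "h u - \<i> * of_real \<eta> \<in> \<Omega> \<inter> g -` ({z. 1 < Re z} \<inter> {z. 0 < Im z})" using e by blast+
    have mir: "mirror (h u - \<i> * of_real \<eta>) = h u + \<i> * of_real \<eta>"
      using u by (simp add: mirror_def complex_eq_iff)
    have hg: "h (g (h u - \<i> * of_real \<eta>)) = h u - \<i> * of_real \<eta>" using in_ball h_g by blast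
    have "g (h u - \<i> * of_real \<eta>) \<in> reflectable"
      using in_ball \<eta> u unfolding reflectable_def mem_Collect_eq hg mir by auto
    from Im_Ln_mirror_ge[OF this] show ?thesis by (simp add: \<theta>_def hg mir)
  qed
  have "u \<noteq> 0" using u by auto
  have "u \<notin> \<real>\<^sub>\<le>\<^sub>0" using u by (auto simp: complex_nonpos_Reals_iff)
  have "((\<lambda>\<zeta>. Ln (g (h u + \<i> * \<zeta>))) has_field_derivative \<i> * (1 / (deriv h u * u))) (at (of_real 0))"
  proof -
    have g': "(g has_field_derivative 1 / deriv h u) (at (h u + \<i> * of_real 0))"
      using g_deriv[OF z] u by simp
    have "((\<lambda>\<zeta>. g (h u + \<i> * \<zeta>)) has_field_derivative 1 / deriv h u * \<i>) (at (of_real 0))"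
      by (rule DERIV_chain2[where f = g and g = "\<lambda>\<zeta>. h u + \<i> * \<zeta>", OF g'])
        (auto intro!: derivative_eq_intros)
    then show ?thesis
      using \<open>u \<notin> \<real>\<^sub>\<le>\<^sub>0\<close> u by (auto intro!: derivative_eq_intros simp: divide_simps)
  qed
  from has_vector_derivative_real_field[OF this]
  have "((\<lambda>\<eta>. Ln (g (h u + \<i> * of_real \<eta>))) has_vector_derivative \<i> * (1 / (deriv h u * u))) (at 0)" .
  from bounded_linear.has_vector_derivative[OF bounded_linear_Im this]
  have \<theta>': "(\<theta> has_real_derivative Re (1 / (deriv h u * u))) (at 0)"
    unfolding Im_i_times by (simp add: \<theta>_def[abs_def] has_real_derivative_iff_has_vector_derivative)
  have "((\<lambda>\<eta>. \<theta> \<eta> - \<theta> (- \<eta>)) has_real_derivative 2 * Re (1 / (deriv h u * u))) (at 0)"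
    using \<theta>' by (auto intro!: derivative_eq_intros DERIV_chain2[where f = \<theta>])
  from DERIV_neg_dec_right[OF this] neg obtain d where d: "0 < d"
      "\<And>\<eta>. 0 < \<eta> \<Longrightarrow> \<eta> < d \<Longrightarrow> \<theta> \<eta> - \<theta> (- \<eta>) < 0"
    by auto
  define \<eta> where "\<eta> = min d e / 2"
  have "0 < \<eta>" "\<eta> < d" "\<eta> < e" using d e by (auto simp: \<eta>_def)
  with d(2) mono show False by fastforce
qed

lemma deriv_h_cnj: "0 < Re w \<Longrightarrow> deriv (cnj \<circ> h \<circ> cnj) w = cnj (deriv h (cnj w))"
  using holomorphic_derivI[OF holomorphic open_H, of "cnj w"]
  by (intro DERIV_imp_deriv has_field_derivative_cnj_cnj) auto

text \<open>Conjugation exchanges the two sides of the ray and so transfers the result for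
  \<open>Im u > 0\<close> to \<open>Im u < 0\<close>.\<close>

lemma koenigs_map_cnj: "koenigs_map (cnj \<circ> h \<circ> cnj)"
proof
  have H: "cnj ` H = H" unfolding image_cnj_conv_vimage_cnj by auto
  then show "(cnj \<circ> h \<circ> cnj) holomorphic_on {w. 0 < Re w}"
    using holomorphic open_H by (intro holomorphic_on_compose_cnj_cnj) auto
  show "0 < Re (deriv (cnj \<circ> h \<circ> cnj) w)" if "0 < Re w" for w
    using Re_deriv_pos[of "cnj w"] deriv_h_cnj[of w] that by simp
  show "(cnj \<circ> h \<circ> cnj) w + of_real t \<in> (cnj \<circ> h \<circ> cnj) ` {w. 0 < Re w}"
    if w: "0 < Re w" "0 \<le> t" for w t
  proof -
    obtain v where v: "0 < Re v" "h (cnj w) + of_real t = h v" using shift[of "cnj w" t] w by auto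
    then have "(cnj \<circ> h \<circ> cnj) w + of_real t = (cnj \<circ> h \<circ> cnj) (cnj v)"
      by (simp flip: v(2))
    then show ?thesis by (rule image_eqI) (use v in simp)
  qed
qed

lemma Re_log_deriv_nonneg:
  assumes u: "1 < Re u" "Im (h u) = Im (h 1)"
  shows "0 \<le> Re (1 / (deriv h u * u))"
proof (cases "Im u" "0::real" rule: linorder_cases)
  case greater
  with u show ?thesis by (intro Re_log_deriv_nonneg_upper)
next
  case less
  have "deriv (cnj \<circ> h \<circ> cnj) (cnj u) = cnj (deriv h u)"
    using deriv_h_cnj[of "cnj u"] u by simp
  with koenigs_map.Re_log_deriv_nonneg_upper[OF koenigs_map_cnj, of "cnj u"] u less
  have "0 \<le> Re (cnj (1 / (deriv h u * u)))" by simp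
  then show ?thesis unfolding cnj.simps .
next
  case equal
  then have "u = of_real (Re u)" by (simp add: complex_eq_iff)
  then have "1 / (deriv h u * u) = 1 / deriv h u / of_real (Re u)" by simp
  then have "Re (1 / (deriv h u * u)) = Re (1 / deriv h u) / Re u"
    by (simp only: Re_divide_of_real)
  then show ?thesis using Re_inverse_pos[OF Re_deriv_pos[of u]] u by simp
qed

lemma cmod_orbit_strict_mono:
  assumes st: "0 \<le> s" "s < t"
  shows "cmod (g (h 1 + of_real s)) < cmod (g (h 1 + of_real t))"
proof -
  \<comment> \<open>The logarithmic derivative of \<open>g\<close>; its real part is the derivative
    of \<open>ln |g|\<close> along the ray.\<close>
  define K where "K z = deriv g z / g z" for z
  have in_\<Omega>: "h 1 + of_real r \<in> \<Omega>" if "0 \<le> r" for r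
    using shift[of 1 r] that by simp
  have K_hol: "K holomorphic_on \<Omega>"
    unfolding K_def[abs_def] using Re_g by (intro holomorphic_intros g_holomorphic open_\<Omega>) force
  define L where "L r = Re (Ln (g (h 1 + of_real r)))" for r
  have L': "(L has_real_derivative Re (K (h 1 + of_real r))) (at r)" if "0 \<le> r" for r
  proof -
    have g': "(g has_field_derivative deriv g (h 1 + of_real r)) (at (h 1 + of_real r))"
      using holomorphic_derivI[OF g_holomorphic open_\<Omega> in_\<Omega>[OF that]] .
    have "((\<lambda>\<zeta>. g (h 1 + \<zeta>)) has_field_derivative deriv g (h 1 + of_real r) * 1) (at (of_real r))"
      by (rule DERIV_chain2[where f = g and g = "\<lambda>\<zeta>. h 1 + \<zeta>", OF g'])
        (auto intro!: derivative_eq_intros)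
    moreover have "g (h 1 + of_real r) \<notin> \<real>\<^sub>\<le>\<^sub>0"
      using Re_g[OF in_\<Omega>[OF that]] by (auto simp: complex_nonpos_Reals_iff)
    ultimately have "((\<lambda>\<zeta>. Ln (g (h 1 + \<zeta>))) has_field_derivative K (h 1 + of_real r)) (at (of_real r))"
      by (auto intro!: derivative_eq_intros simp: K_def divide_simps)
    from bounded_linear.has_vector_derivative[OF bounded_linear_Re has_vector_derivative_real_field[OF this]]
    show ?thesis by (simp add: L_def[abs_def] has_real_derivative_iff_has_vector_derivative)
  qed
  have K_eq: "K (h 1 + of_real r) = 1 / (deriv h (g (h 1 + of_real r)) * g (h 1 + of_real r))"
    if "0 \<le> r" for r
    using DERIV_imp_deriv[OF g_deriv[OF in_\<Omega>[OF that]]] by (simp add: K_def)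
  have K0: "0 < Re (K (h 1 + of_real 0))"
    using K_eq[of 0] Re_inverse_pos[OF Re_deriv_pos[of 1]] by simp
  have K_nonneg: "0 \<le> Re (K (h 1 + of_real r))" if "0 \<le> r" for r
  proof (cases "r = 0")
    case False
    then have r: "0 < r" using that by simp
    have "1 < Re (g (h 1 + of_real r))" using Re_g_less[of "h 1" r] r by simp
    moreover have "Im (h (g (h 1 + of_real r))) = Im (h 1)" using h_g[OF in_\<Omega>[OF that]] by simp
    ultimately show ?thesis unfolding K_eq[OF that] by (rule Re_log_deriv_nonneg)
  qed (use K0 in simp)
  have L_mono: "L a \<le> L b" if "0 \<le> a" "a \<le> b" for a b
    using that(2)
  proof (rule DERIV_nonneg_imp_nondecreasing)
    fix x assume "a \<le> x" "x \<le> b"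
    then show "\<exists>y. (L has_real_derivative y) (at x) \<and> 0 \<le> y"
      using that by (intro exI[of _ "Re (K (h 1 + of_real x))"] conjI L' K_nonneg) auto
  qed
  have "L s \<noteq> L t"
  proof
    assume eq: "L s = L t"
    have zero: "Re (K (h 1 + of_real r)) = 0" if r: "s < r" "r < t" for r
    proof -
      have const: "L s = L x" if "x \<in> {s<..<t}" for x
        using L_mono[of s x] L_mono[of x t] st that eq by simp
      have "((\<lambda>_. L s) has_real_derivative 0) (at r)" by simp
      then have "(L has_real_derivative 0) (at r)"
        by (rule has_field_derivative_transform_within_open[of _ _ _ "{s<..<t}"]) (use r const in auto)
      moreover have "0 \<le> r" using r st by simp
      ultimately show ?thesis using DERIV_unique L' by blast
    qed
    \<comment> \<open>\<open>Re K\<close> is not holomorphic. On a set symmetric about the real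
      axis, the sum of \<open>K (h 1 + \<zeta>)\<close> and its Schwarz reflection is, and on the
      ray it equals \<open>2 * Re K\<close>; the identity theorem is applied to this sum.\<close>
    define U where "U = (\<lambda>\<zeta>. h 1 + \<zeta>) -` \<Omega> \<inter> (\<lambda>\<zeta>. h 1 + cnj \<zeta>) -` \<Omega>"
    define \<Psi> where "\<Psi> \<zeta> = K (h 1 + \<zeta>) + cnj (K (h 1 + cnj \<zeta>))" for \<zeta>
    have \<Psi>_real: "\<Psi> (of_real r) = of_real (2 * Re (K (h 1 + of_real r)))" for r
      by (simp add: \<Psi>_def complex_eq_iff)
    have open_U: "open U"
      unfolding U_def by (intro open_Int open_vimage open_\<Omega> continuous_intros)
    have cnj_U: "cnj ` U = U" unfolding image_cnj_conv_vimage_cnj by (auto simp: U_def)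
    have K_hol': "(\<lambda>\<zeta>. K (h 1 + \<zeta>)) holomorphic_on U"
      by (intro holomorphic_on_compose_gen[OF _ K_hol, unfolded o_def] holomorphic_intros)
        (auto simp: U_def)
    have "cnj \<circ> (\<lambda>\<zeta>. K (h 1 + \<zeta>)) \<circ> cnj holomorphic_on U"
      using K_hol' cnj_U open_U by (intro holomorphic_on_compose_cnj_cnj) auto
    then have \<Psi>_hol: "\<Psi> holomorphic_on U"
      unfolding \<Psi>_def[abs_def] using K_hol' by (intro holomorphic_intros) (auto simp: o_def)
    \<comment> \<open>\<open>U\<close> need not be connected, but the component of \<open>0\<close>
      contains the whole ray, hence both the interval where \<open>\<Psi>\<close> vanishes and the
      point \<open>0\<close>.\<close>
    define C where "C = connected_component_set U 0"
    have ray: "of_real ` {0..} \<subseteq> C"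
    proof -
      have "connected (of_real ` {0::real..} :: complex set)"
        by (intro connected_continuous_image continuous_intros) auto
      moreover have "of_real ` {0::real..} \<subseteq> U" using in_\<Omega> by (auto simp: U_def)
      ultimately show ?thesis unfolding C_def by (intro connected_component_maximal) auto
    qed
    have "\<Psi> (of_real 0) = 0"
    proof (rule analytic_continuation[of \<Psi> C "of_real ` {s<..<t}" "of_real ((s + t) / 2)"])
      show "\<Psi> holomorphic_on C"
        using \<Psi>_hol connected_component_subset unfolding C_def by (rule holomorphic_on_subset)
      show "open C" unfolding C_def using open_U by (rule open_connected_component)
      show "connected C" unfolding C_def by simp
      show "of_real ` {s<..<t} \<subseteq> C" using ray st by force
      show "of_real ((s + t) / 2) \<in> C" using st by (intro subsetD[OF ray] imageI) auto
      show "of_real ((s + t) / 2) islimpt (of_real ` {s<..<t} :: complex set)"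
      proof (rule connected_imp_perfect)
        show "connected (of_real ` {s<..<t} :: complex set)"
          by (intro connected_continuous_image continuous_intros) auto
        show "of_real ((s + t) / 2) \<in> (of_real ` {s<..<t} :: complex set)" using st by (intro imageI) auto
        show "of_real ` {s<..<t} \<noteq> {a}" for a :: complex
        proof
          assume a: "of_real ` {s<..<t} = {a}"
          have "of_real ((s + t) / 2) \<in> (of_real ` {s<..<t} :: complex set)"
            "of_real ((s + 2 * t) / 3) \<in> (of_real ` {s<..<t} :: complex set)"
            using st by (intro imageI; auto)+
          then have "complex_of_real ((s + t) / 2) = of_real ((s + 2 * t) / 3)" unfolding a by auto
          then show False using st unfolding of_real_eq_iff by simp
        qed
      qed
      show "\<Psi> z = 0" if "z \<in> of_real ` {s<..<t}" for z
        using that zero by (auto simp: \<Psi>_real)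
      show "of_real 0 \<in> C" using ray by (meson atLeast_iff imageI order_refl subsetD)
    qed
    then show False using K0 \<Psi>_real[of 0] by simp
  qed
  then have less: "L s < L t" using L_mono[of s t] st by simp
  have L_ln: "L r = ln (cmod (g (h 1 + of_real r)))" "0 < cmod (g (h 1 + of_real r))" if "0 \<le> r" for r
  proof -
    have "g (h 1 + of_real r) \<noteq> 0" using Re_g[OF in_\<Omega>[OF that]] by auto
    then show "L r = ln (cmod (g (h 1 + of_real r)))" "0 < cmod (g (h 1 + of_real r))"
      by (simp_all add: L_def Re_Ln)
  qed
  show ?thesis using less st L_ln[of s] L_ln[of t] by simp
qed

end

section \<open>Differentiability of orbits and the Koenigs function\<close>

lemma norm_deriv_le:
  assumes f: "f holomorphic_on ball 0 R" "\<And>z. z \<in> ball 0 R \<Longrightarrow> cmod (f z) \<le> M"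
    and z: "cmod z \<le> \<rho>" "\<rho> < R"
  shows "cmod (deriv f z) \<le> 2 * M / (R - \<rho>)"
proof -
  define r where "r = (R - \<rho>) / 2"
  have r: "0 < r" using z by (simp add: r_def)
  have sub: "cball z r \<subseteq> ball 0 R"
  proof
    fix w assume "w \<in> cball z r"
    then have "cmod w \<le> cmod z + r"
      using norm_triangle_ineq2[of w z] by (simp add: dist_norm norm_minus_commute)
    moreover have "\<rho> + r < R" using z by (simp add: r_def field_simps)
    ultimately show "w \<in> ball 0 R" using z by simp
  qed
  have "cmod ((deriv ^^ 1) f z) \<le> fact 1 * M / r ^ 1"
  proof (rule Cauchy_inequality)
    show "f holomorphic_on ball z r"
      using f(1) sub ball_subset_cball by (meson holomorphic_on_subset order_trans)
    show "continuous_on (cball z r) f"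
      using f(1) sub holomorphic_on_imp_continuous_on holomorphic_on_subset by blast
    show "cmod (f w) \<le> M" if "cmod (z - w) = r" for w
      using f(2)[of w] sub that by (auto simp: dist_norm)
  qed (fact r)
  then show ?thesis by (simp add: r_def field_simps)
qed

lemma holomorphic_bounded_lipschitz:
  assumes f: "f holomorphic_on ball 0 R" "\<And>z. z \<in> ball 0 R \<Longrightarrow> cmod (f z) \<le> M"
    and \<rho>: "\<rho> < R" and zw: "z \<in> cball 0 \<rho>" "w \<in> cball 0 \<rho>"
  shows "cmod (f z - f w) \<le> 2 * M / (R - \<rho>) * cmod (z - w)"
proof (rule field_differentiable_bound[where f' = "deriv f" and S = "cball 0 \<rho>"])
  show "(f has_field_derivative deriv f x) (at x within cball 0 \<rho>)" if "x \<in> cball 0 \<rho>" for x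
    using f(1) that \<rho> by (intro holomorphic_derivI[of _ "ball 0 R"]) auto
  show "cmod (deriv f x) \<le> 2 * M / (R - \<rho>)" if "x \<in> cball 0 \<rho>" for x
    using that by (intro norm_deriv_le[OF f] \<rho>) auto
qed (use zw in auto)

text \<open>Two Cauchy estimates, separated by the radius \<open>\<sigma>\<close> halfway between
  \<open>\<rho>\<close> and \<open>R\<close>. Each contributes a factor \<open>2\<close> and each
  works with half the gap, hence \<open>16\<close>.\<close>

lemma holomorphic_bounded_deriv_lipschitz:
  assumes f: "f holomorphic_on ball 0 R" "\<And>z. z \<in> ball 0 R \<Longrightarrow> cmod (f z) \<le> M"
    and \<rho>: "\<rho> < R" and zw: "z \<in> cball 0 \<rho>" "w \<in> cball 0 \<rho>"
  shows "cmod (deriv f z - deriv f w) \<le> 16 * M / (R - \<rho>)\<^sup>2 * cmod (z - w)"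
proof -
  define \<sigma> where "\<sigma> = (R + \<rho>) / 2"
  have \<sigma>: "\<rho> < \<sigma>" "\<sigma> < R" using \<rho> by (simp_all add: \<sigma>_def)
  have "cmod (deriv f z - deriv f w) \<le> 2 * (2 * M / (R - \<sigma>)) / (\<sigma> - \<rho>) * cmod (z - w)"
  proof (rule holomorphic_bounded_lipschitz[OF _ _ \<sigma>(1) zw])
    show "deriv f holomorphic_on ball 0 \<sigma>"
      using f(1) \<sigma> holomorphic_deriv[OF f(1)] by (auto intro: holomorphic_on_subset)
    show "cmod (deriv f x) \<le> 2 * M / (R - \<sigma>)" if "x \<in> ball 0 \<sigma>" for x
      using that by (intro norm_deriv_le[OF f] \<sigma>(2)) auto
  qed
  also have "2 * (2 * M / (R - \<sigma>)) / (\<sigma> - \<rho>) = 16 * M / (R - \<rho>)\<^sup>2"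
  proof -
    have "R - \<sigma> = (R - \<rho>) / 2" "\<sigma> - \<rho> = (R - \<rho>) / 2" by (simp_all add: \<sigma>_def field_simps)
    then show ?thesis using \<rho> by (simp only:) (simp add: power2_eq_square)
  qed
  finally show ?thesis .
qed

lemma holomorphic_difference_quotient_bound:
  assumes f: "f holomorphic_on ball 0 R" and \<rho>: "\<rho> < R"
    and L: "\<And>z w. z \<in> cball 0 \<rho> \<Longrightarrow> w \<in> cball 0 \<rho> \<Longrightarrow> cmod (deriv f z - deriv f w) \<le> L * cmod (z - w)"
    and z: "ball z r \<subseteq> cball 0 \<rho>" and \<eta>: "\<eta> \<noteq> 0" "cmod \<eta> < r" and L0: "0 \<le> L"
  shows "cmod ((f (z + \<eta>) - f z) / \<eta> - deriv f z) \<le> L * cmod \<eta>"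
proof -
  define g where "g x = f x - deriv f z * x" for x
  define S where "S = closed_segment z (z + \<eta>)"
  have S: "x \<in> cball 0 \<rho>" "cmod (x - z) \<le> cmod \<eta>" if "x \<in> S" for x
  proof -
    show "cmod (x - z) \<le> cmod \<eta>"
      using segment_bound(1)[of x z "z + \<eta>"] that by (simp add: S_def)
    then have "x \<in> ball z r" using \<eta> by (simp add: dist_norm norm_minus_commute)
    then show "x \<in> cball 0 \<rho>" using z by blast
  qed
  have zS: "z \<in> S" "z + \<eta> \<in> S" by (simp_all add: S_def)
  have "cmod (g (z + \<eta>) - g z) \<le> L * cmod \<eta> * cmod (z + \<eta> - z)"
  proof (rule field_differentiable_bound[where f' = "\<lambda>x. deriv f x - deriv f z" and S = S])
    show "(g has_field_derivative deriv f x - deriv f z) (at x within S)" if "x \<in> S" for x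
      unfolding g_def using S[OF that] \<rho>
      by (auto intro!: derivative_eq_intros holomorphic_derivI[OF f])
    show "cmod (deriv f x - deriv f z) \<le> L * cmod \<eta>" if "x \<in> S" for x
      using L[of x z] S[OF that] S[OF zS(1)] mult_left_mono[OF S(2)[OF that] L0] by linarith
  qed (use zS in \<open>auto simp: S_def\<close>)
  then have "cmod ((g (z + \<eta>) - g z) / \<eta>) \<le> L * cmod \<eta>"
    using \<eta> by (simp add: norm_divide divide_simps)
  also have "(g (z + \<eta>) - g z) / \<eta> = (f (z + \<eta>) - f z) / \<eta> - deriv f z"
    using \<eta> by (simp add: g_def field_simps)
  finally show ?thesis .
qed

text \<open>The difference quotients are continuous in \<open>s\<close> and converge uniformly in
  \<open>s\<close>, because their error is bounded by a constant depending only on \<open>M\<close>,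
  \<open>R\<close> and \<open>\<rho>\<close>.\<close>

lemma continuous_on_deriv_parameter:
  fixes f :: "'a::topological_space \<Rightarrow> complex \<Rightarrow> complex"
  assumes hol: "\<And>s. s \<in> A \<Longrightarrow> f s holomorphic_on ball 0 R"
    and bound: "\<And>s z. s \<in> A \<Longrightarrow> z \<in> ball 0 R \<Longrightarrow> cmod (f s z) \<le> M"
    and cont: "\<And>z. z \<in> ball 0 R \<Longrightarrow> continuous_on A (\<lambda>s. f s z)"
    and z: "z \<in> ball 0 R"
  shows "continuous_on A (\<lambda>s. deriv (f s) z)"
proof (cases "A = {}")
  case False
  define \<rho> where "\<rho> = (R + cmod z) / 2"
  define r where "r = \<rho> - cmod z"
  have \<rho>: "\<rho> < R" and r: "0 < r" using z by (simp_all add: \<rho>_def r_def)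
  have sub: "ball z r \<subseteq> cball 0 \<rho>"
  proof
    fix w assume "w \<in> ball z r"
    then have "cmod w < cmod z + r"
      using norm_triangle_ineq2[of w z] by (simp add: dist_norm norm_minus_commute)
    then show "w \<in> cball 0 \<rho>" by (simp add: r_def)
  qed
  have M: "0 \<le> M"
  proof -
    obtain s where "s \<in> A" using False by blast
    then show ?thesis using bound[of s z] z norm_ge_zero[of "f s z"] by linarith
  qed
  define L where "L = 16 * M / (R - \<rho>)\<^sup>2"
  have L: "0 \<le> L" using M by (simp add: L_def)
  have "continuous_on A (\<lambda>s. (f s (z + \<eta>) - f s z) / \<eta>)" if "\<eta> \<noteq> 0" "cmod \<eta> < r" for \<eta> :: complex
  proof -
    have "z + \<eta> \<in> ball z r" using that by (simp add: dist_norm)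
    then have "z + \<eta> \<in> ball 0 R" using sub \<rho> by fastforce
    then show ?thesis using z that by (intro continuous_intros cont) auto
  qed
  then have "\<forall>\<^sub>F \<eta> in at 0. continuous_on A (\<lambda>s. (f s (z + \<eta>) - f s z) / \<eta>)"
    unfolding eventually_at using r by (intro exI[of _ r]) auto
  moreover have "uniform_limit A (\<lambda>\<eta> s. (f s (z + \<eta>) - f s z) / \<eta>) (\<lambda>s. deriv (f s) z) (at 0)"
  proof (rule uniform_limitI)
    fix e :: real assume e: "0 < e"
    show "\<forall>\<^sub>F \<eta> in at 0. \<forall>s\<in>A. dist ((f s (z + \<eta>) - f s z) / \<eta>) (deriv (f s) z) < e"
      unfolding eventually_at
    proof (intro exI[of _ "min r (e / (L + 1))"] conjI ballI impI)
      show "0 < min r (e / (L + 1))" using r e L by simp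
      fix \<eta> :: complex and s assume \<eta>: "\<eta> \<noteq> 0 \<and> dist \<eta> 0 < min r (e / (L + 1))" and s: "s \<in> A"
      have "cmod ((f s (z + \<eta>) - f s z) / \<eta> - deriv (f s) z) \<le> L * cmod \<eta>"
      proof (rule holomorphic_difference_quotient_bound[OF hol[OF s] \<rho> _ sub _ _ L])
        show "cmod (deriv (f s) v - deriv (f s) w) \<le> L * cmod (v - w)"
          if "v \<in> cball 0 \<rho>" "w \<in> cball 0 \<rho>" for v w
          unfolding L_def using bound[OF s] that
          by (intro holomorphic_bounded_deriv_lipschitz[OF hol[OF s] _ \<rho>]) auto
      qed (use \<eta> in auto)
      also have "\<dots> \<le> (L + 1) * cmod \<eta>" by (simp add: mult_right_mono)
      also have "\<dots> < e" using \<eta> L by (simp add: field_simps)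
      finally show "dist ((f s (z + \<eta>) - f s z) / \<eta>) (deriv (f s) z) < e"
        by (simp add: dist_norm)
    qed
  qed
  ultimately show ?thesis by (rule uniform_limit_theorem) simp
qed simp

text \<open>A change of both variables splits into a move in \<open>x\<close>, controlled uniformly
  in \<open>s\<close>, and a move in \<open>s\<close> at fixed \<open>x\<close>. This gives the
  joint continuity needed to differentiate under the integral sign.\<close>

lemma continuous_on_Times_lipschitz:
  fixes F :: "'a::metric_space \<Rightarrow> 'b::metric_space \<Rightarrow> 'c::metric_space"
  assumes lip: "\<And>x y s. x \<in> X \<Longrightarrow> y \<in> X \<Longrightarrow> s \<in> S \<Longrightarrow> dist (F x s) (F y s) \<le> L * dist x y"
    and cont: "\<And>x. x \<in> X \<Longrightarrow> continuous_on S (F x)"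
  shows "continuous_on (X \<times> S) (\<lambda>(x, s). F x s)"
  unfolding continuous_on_def
proof safe
  fix x s assume xs: "x \<in> X" "s \<in> S"
  have "continuous_on (X \<times> S) (\<lambda>p. F x (snd p))"
    by (rule continuous_on_compose2[OF cont[OF xs(1)] continuous_on_snd]) auto
  then have snd: "((\<lambda>p. F x (snd p)) \<longlongrightarrow> F x s) (at (x, s) within X \<times> S)"
    using xs by (auto simp: continuous_on_def)
  have "((\<lambda>p. L * dist (fst p) x + dist (F x (snd p)) (F x s)) \<longlongrightarrow>
      L * dist (fst (x, s)) x + dist (F x s) (F x s)) (at (x, s) within X \<times> S)"
    by (intro tendsto_intros snd)
  then have lim: "((\<lambda>p. L * dist (fst p) x + dist (F x (snd p)) (F x s)) \<longlongrightarrow> 0)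
      (at (x, s) within X \<times> S)" by simp
  have "\<forall>\<^sub>F p in at (x, s) within X \<times> S.
      dist (case p of (x, s) \<Rightarrow> F x s) (F x s) \<le> L * dist (fst p) x + dist (F x (snd p)) (F x s)"
  proof (rule eventually_mono[OF eventually_at_topological[THEN iffD2]])
    show "\<exists>T. open T \<and> (x, s) \<in> T \<and> (\<forall>p\<in>T. p \<noteq> (x, s) \<longrightarrow> p \<in> X \<times> S \<longrightarrow> p \<in> X \<times> S)"
      by (intro exI[of _ UNIV]) auto
    fix p assume "p \<in> X \<times> S"
    then show "dist (case p of (x, s) \<Rightarrow> F x s) (F x s) \<le> L * dist (fst p) x + dist (F x (snd p)) (F x s)"
      using lip[of "fst p" x "snd p"] dist_triangle[of "F (fst p) (snd p)" "F x s" "F x (snd p)"] xs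
      by (auto simp: split_beta)
  qed
  then have "((\<lambda>p. dist (case p of (x, s) \<Rightarrow> F x s) (F x s)) \<longlongrightarrow> 0) (at (x, s) within X \<times> S)"
    by (intro tendsto_sandwich[OF _ _ tendsto_const lim]) auto
  then show "((\<lambda>(x, s). F x s) \<longlongrightarrow> F x s) (at (x, s) within X \<times> S)"
    by (subst tendsto_dist_iff)
qed

section \<open>Averages of the flow and smoothness of orbits\<close>

locale disc_flow =
  fixes \<phi> :: "real \<Rightarrow> complex \<Rightarrow> complex"
  assumes flow: "disc_semigroup \<phi>"
begin

lemma flow_holomorphic: "0 \<le> t \<Longrightarrow> \<phi> t holomorphic_on ball 0 1"
  and flow_in_ball: "0 \<le> t \<Longrightarrow> z \<in> ball 0 1 \<Longrightarrow> \<phi> t z \<in> ball 0 1"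
  and flow_0: "z \<in> ball 0 1 \<Longrightarrow> \<phi> 0 z = z"
  and flow_add: "0 \<le> t \<Longrightarrow> 0 \<le> s \<Longrightarrow> z \<in> ball 0 1 \<Longrightarrow> \<phi> (t + s) z = \<phi> t (\<phi> s z)"
  and flow_continuous: "z \<in> ball 0 1 \<Longrightarrow> continuous_on {0..} (\<lambda>t. \<phi> t z)"
  using flow unfolding disc_semigroup_def continuous_on_def by blast+

lemma norm_flow_le: "0 \<le> t \<Longrightarrow> z \<in> ball 0 1 \<Longrightarrow> cmod (\<phi> t z) \<le> 1"
  using flow_in_ball[of t z] by simp

lemma flow_continuous_Icc: "z \<in> ball 0 1 \<Longrightarrow> 0 \<le> a \<Longrightarrow> continuous_on {a..b} (\<lambda>t. \<phi> t z)"
  by (rule continuous_on_subset[OF flow_continuous]) auto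

lemma flow_deriv_continuous: "z \<in> ball 0 1 \<Longrightarrow> continuous_on {0..} (\<lambda>t. deriv (\<phi> t) z)"
  by (rule continuous_on_deriv_parameter[of _ _ 1 1])
    (auto intro: flow_holomorphic flow_continuous norm_flow_le)

definition avg where "avg \<delta> z = integral {0..\<delta>} (\<lambda>s. \<phi> s z)"

lemma avg_has_field_derivative:
  assumes z: "z \<in> ball 0 1"
  shows "(avg \<delta> has_field_derivative integral {0..\<delta>} (\<lambda>s. deriv (\<phi> s) z)) (at z)"
proof -
  define \<rho> where "\<rho> = (1 + cmod z) / 2"
  have \<rho>: "\<rho> < 1" "cmod z < \<rho>" using z by (simp_all add: \<rho>_def)
  have "continuous_on (ball 0 \<rho> \<times> {0..\<delta>}) (\<lambda>(x, s). deriv (\<phi> s) x)"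
  proof (rule continuous_on_Times_lipschitz)
    show "dist (deriv (\<phi> s) x) (deriv (\<phi> s) y) \<le> 16 * 1 / (1 - \<rho>)\<^sup>2 * dist x y"
      if "x \<in> ball 0 \<rho>" "y \<in> ball 0 \<rho>" "s \<in> {0..\<delta>}" for x y s
      unfolding dist_norm using that
      by (intro holomorphic_bounded_deriv_lipschitz flow_holomorphic norm_flow_le \<rho>) auto
    show "continuous_on {0..\<delta>} (\<lambda>s. deriv (\<phi> s) x)" if "x \<in> ball 0 \<rho>" for x
      by (rule continuous_on_subset[OF flow_deriv_continuous]) (use that \<rho> in auto)
  qed
  then have "((\<lambda>x. integral (cbox 0 \<delta>) (\<lambda>s. \<phi> s x)) has_field_derivative
      integral (cbox 0 \<delta>) (\<lambda>s. deriv (\<phi> s) z)) (at z within ball 0 \<rho>)"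
  proof (intro leibniz_rule_field_derivative)
    fix x t assume xt: "x \<in> ball (0::complex) \<rho>" "t \<in> cbox 0 \<delta>"
    then show "(\<phi> t has_field_derivative deriv (\<phi> t) x) (at x within ball 0 \<rho>)"
      using \<rho> by (intro holomorphic_derivI[OF flow_holomorphic]) auto
  next
    fix x assume "x \<in> ball (0::complex) \<rho>"
    then show "(\<lambda>t. \<phi> t x) integrable_on cbox 0 \<delta>"
      using \<rho> by (intro integrable_continuous flow_continuous_Icc[unfolded cbox_interval[symmetric]]) auto
  qed (use \<rho> in auto)
  then show ?thesis
    using \<rho> by (simp add: avg_def[abs_def] at_within_open[of z "ball 0 \<rho>"])
qed

lemma avg_holomorphic: "avg \<delta> holomorphic_on ball 0 1"
  using avg_has_field_derivative by (meson holomorphic_on_open open_ball)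

text \<open>\<open>\<phi> 0\<close> is the identity, so \<open>deriv (\<phi> s) z\<close> is close
  to \<open>1\<close> for small \<open>s\<close>, and its integral up to \<open>\<delta>\<close>
  differs from \<open>\<delta>\<close> by at most \<open>\<delta> / 2\<close>.\<close>

lemma deriv_avg_nonzero:
  assumes z: "z \<in> ball 0 1"
  obtains \<delta> where "0 < \<delta>" "deriv (avg \<delta>) z \<noteq> 0"
proof -
  have "deriv (\<phi> 0) z = deriv (\<lambda>z. z) z"
    by (rule complex_derivative_transform_within_open[of _ "ball 0 1"])
      (use z flow_0 flow_holomorphic[of 0] in auto)
  then have d0: "deriv (\<phi> 0) z = 1" by simp
  obtain d where d: "0 < d" "\<And>s. 0 \<le> s \<Longrightarrow> s < d \<Longrightarrow> cmod (deriv (\<phi> s) z - 1) < 1 / 2"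
    using flow_deriv_continuous[OF z, unfolded continuous_on_iff, rule_format, of 0 "1/2"] d0
    by (auto simp: dist_norm)
  define \<delta> where "\<delta> = d / 2"
  have \<delta>: "0 < \<delta>" "\<delta> < d" using d by (simp_all add: \<delta>_def)
  have cont: "continuous_on {0..\<delta>} (\<lambda>s. deriv (\<phi> s) z)"
    by (rule continuous_on_subset[OF flow_deriv_continuous[OF z]]) auto
  have "cmod (integral {0..\<delta>} (\<lambda>s. deriv (\<phi> s) z - 1)) \<le> 1 / 2 * (\<delta> - 0)"
    using \<delta> d by (intro integral_bound continuous_intros cont) (auto intro: less_imp_le)
  also have "integral {0..\<delta>} (\<lambda>s. deriv (\<phi> s) z - 1) = deriv (avg \<delta>) z - of_real \<delta>"
    using \<delta> cont DERIV_imp_deriv[OF avg_has_field_derivative[OF z]]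
    by (subst integral_diff) (auto intro: integrable_continuous_interval simp: scaleR_conv_of_real)
  finally have "deriv (avg \<delta>) z \<noteq> 0" using \<delta> by auto
  with \<delta>(1) that show ?thesis by blast
qed

text \<open>
  Averaging smooths the orbits: \<open>avg \<delta> (\<phi> t z)\<close> is the integral of \<open>\<phi> s z\<close> for \<open>s\<close> from \<open>t\<close> to \<open>t + \<delta>\<close>.
\<close>

lemma avg_flow_has_vector_derivative:
  assumes z: "z \<in> ball 0 1" and \<delta>: "0 \<le> \<delta>" and t: "t \<in> {0..b}"
  shows "((\<lambda>t. avg \<delta> (\<phi> t z)) has_vector_derivative \<phi> \<delta> (\<phi> t z) - \<phi> t z) (at t within {0..b})"
proof -
  define I where "I x = integral {0..x} (\<lambda>s. \<phi> s z)" for x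
  have I': "(I has_vector_derivative \<phi> x z) (at x within {0..b + \<delta>})" if "x \<in> {0..b + \<delta>}" for x
    unfolding I_def[abs_def] by (intro integral_has_vector_derivative flow_continuous_Icc z that) auto
  have eq: "avg \<delta> (\<phi> x z) = I (x + \<delta>) - I x" if x: "x \<in> {0..b}" for x
  proof -
    have "avg \<delta> (\<phi> x z) = integral {0..\<delta>} ((\<lambda>s. \<phi> s z) \<circ> (\<lambda>s. s + x))"
      unfolding avg_def using x z by (intro integral_cong) (auto simp: flow_add)
    also have "\<dots> = integral {0 + x..\<delta> + x} (\<lambda>s. \<phi> s z)"
      using x z by (intro integral_shift flow_continuous_Icc) auto
    also have "\<dots> = I (x + \<delta>) - I x"
      unfolding I_def using x \<delta> z Henstock_Kurzweil_Integration.integral_combine[where a = 0 and c = x and b = "x + \<delta>" and f = "\<lambda>s. \<phi> s z"]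
      by (simp add: algebra_simps integrable_continuous_interval flow_continuous_Icc)
    finally show ?thesis .
  qed
  have "((I \<circ> (\<lambda>x. x + \<delta>)) has_vector_derivative 1 *\<^sub>R \<phi> (t + \<delta>) z) (at t within {0..b})"
  proof (rule vector_diff_chain_within)
    show "((\<lambda>x. x + \<delta>) has_vector_derivative 1) (at t within {0..b})"
      by (auto intro!: derivative_eq_intros)
    show "(I has_vector_derivative \<phi> (t + \<delta>) z) (at (t + \<delta>) within (\<lambda>x. x + \<delta>) ` {0..b})"
      by (rule has_vector_derivative_within_subset[OF I']) (use t \<delta> in auto)
  qed
  moreover have "(I has_vector_derivative \<phi> t z) (at t within {0..b})"
    by (rule has_vector_derivative_within_subset[OF I']) (use t \<delta> in auto)
  ultimately have "((\<lambda>x. I (x + \<delta>) - I x) has_vector_derivative \<phi> (t + \<delta>) z - \<phi> t z) (at t within {0..b})"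
    using has_vector_derivative_diff by (fastforce simp: o_def)
  then have "((\<lambda>x. avg \<delta> (\<phi> x z)) has_vector_derivative \<phi> (t + \<delta>) z - \<phi> t z) (at t within {0..b})"
    by (rule has_vector_derivative_transform[OF t, rotated]) (rule eq)
  moreover have "\<phi> (t + \<delta>) z = \<phi> \<delta> (\<phi> t z)" using flow_add[of \<delta> t z] t \<delta> z by (simp add: add.commute)
  ultimately show ?thesis by simp
qed

text \<open>Near \<open>p\<close> the map \<open>avg \<delta>\<close> has a holomorphic inverse
  \<open>k\<close>. Near time \<open>t\<close> the orbit is therefore \<open>k\<close> applied to
  the averaged orbit, which is differentiable by the fundamental theorem of calculus.\<close>

lemma flow_differentiable:
  assumes z: "z \<in> ball 0 1" and t: "t \<in> {0..b}"
  obtains v where "((\<lambda>t. \<phi> t z) has_vector_derivative v) (at t within {0..b})"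
proof -
  define p where "p = \<phi> t z"
  have p: "p \<in> ball 0 1" using flow_in_ball t z by (simp add: p_def)
  obtain \<delta> where \<delta>: "0 < \<delta>" "deriv (avg \<delta>) p \<noteq> 0" using deriv_avg_nonzero[OF p] .
  obtain r where r: "0 < r" "ball p r \<subseteq> ball 0 1" "inj_on (avg \<delta>) (ball p r)"
    using has_complex_derivative_locally_injective[OF avg_holomorphic p open_ball \<delta>(2)] .
  have hol: "avg \<delta> holomorphic_on ball p r" using avg_holomorphic r(2) by (rule holomorphic_on_subset)
  obtain k where k: "k holomorphic_on avg \<delta> ` ball p r" "\<And>x. x \<in> ball p r \<Longrightarrow> k (avg \<delta> x) = x"
    using holomorphic_has_inverse[OF hol open_ball r(3)] by metis
  have "open (avg \<delta> ` ball p r)" using hol open_ball r(3) by (rule open_mapping_thm3)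
  moreover have "avg \<delta> p \<in> avg \<delta> ` ball p r" using r by auto
  ultimately have k': "(k has_field_derivative deriv k (avg \<delta> p)) (at (avg \<delta> (\<phi> t z)) within (\<lambda>t. avg \<delta> (\<phi> t z)) ` {0..b})"
    unfolding p_def[symmetric] using k(1) holomorphic_derivI by blast
  have D: "((k \<circ> (\<lambda>t. avg \<delta> (\<phi> t z))) has_vector_derivative (\<phi> \<delta> p - p) * deriv k (avg \<delta> p)) (at t within {0..b})"
    using field_vector_diff_chain_within[OF avg_flow_has_vector_derivative[OF z less_imp_le[OF \<delta>(1)] t] k']
    by (simp add: p_def)
  obtain d where d: "0 < d" "\<And>x. x \<in> {0..b} \<Longrightarrow> dist x t < d \<Longrightarrow> dist (\<phi> x z) p < r"
    using flow_continuous_Icc[OF z order_refl, of b, unfolded continuous_on_iff, rule_format, OF t r(1)]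
    by (auto simp: p_def)
  have "((\<lambda>t. \<phi> t z) has_vector_derivative (\<phi> \<delta> p - p) * deriv k (avg \<delta> p)) (at t within {0..b})"
    by (rule has_vector_derivative_transform_within[OF D d(1) t]) (use d k in \<open>auto simp: dist_commute\<close>)
  then show ?thesis using that by blast
qed

text \<open>
  Differentiating \<open>avg 1 (\<phi> t z)\<close> along an orbit in two ways shows that the primitive of
  \<open>deriv (avg 1) / (\<phi> 1 - id)\<close> grows at unit speed.
\<close>

lemma koenigs_function:
  assumes ne: "non_elliptic \<phi>"
  obtains k where "k holomorphic_on ball 0 1"
    "\<And>z t. z \<in> ball 0 1 \<Longrightarrow> 0 \<le> t \<Longrightarrow> k (\<phi> t z) = k z + of_real t"
proof -
  have nz: "\<phi> 1 z - z \<noteq> 0" if "z \<in> ball 0 1" for z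
    using ne that by (simp add: non_elliptic_def)
  have "(\<lambda>z. deriv (avg 1) z / (\<phi> 1 z - z)) holomorphic_on ball 0 1"
    using nz by (intro holomorphic_intros avg_holomorphic flow_holomorphic) auto
  then obtain k where k: "\<And>z. z \<in> ball 0 1 \<Longrightarrow> (k has_field_derivative deriv (avg 1) z / (\<phi> 1 z - z)) (at z within ball 0 1)"
    by (rule holomorphic_convex_primitive'[OF convex_ball open_ball]) blast
  then have k': "(k has_field_derivative deriv (avg 1) z / (\<phi> 1 z - z)) (at z)" if "z \<in> ball 0 1" for z
    using that by (metis at_within_open open_ball)
  have "k (\<phi> b z) = k z + of_real b" if z: "z \<in> ball 0 1" and b: "0 \<le> b" for z b
  proof (cases "b = 0")
    \<comment> \<open>Derivatives within \<open>{0..b}\<close> are unique only on a nondegenerate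
      interval.\<close>
    case False
    have "((\<lambda>t. k (\<phi> t z) - of_real t) has_vector_derivative 0) (at t within {0..b})" if t: "t \<in> {0..b}" for t
    proof -
      obtain v where v: "((\<lambda>t. \<phi> t z) has_vector_derivative v) (at t within {0..b})"
        using flow_differentiable[OF z t] .
      have p: "\<phi> t z \<in> ball 0 1" using flow_in_ball t z by simp
      have "(avg 1 has_field_derivative deriv (avg 1) (\<phi> t z)) (at (\<phi> t z) within (\<lambda>t. \<phi> t z) ` {0..b})"
        using avg_holomorphic p by (intro holomorphic_derivI) auto
      from field_vector_diff_chain_within[OF v this]
      have "((\<lambda>t. avg 1 (\<phi> t z)) has_vector_derivative v * deriv (avg 1) (\<phi> t z)) (at t within {0..b})"
        by (simp add: o_def)
      moreover have "((\<lambda>t. avg 1 (\<phi> t z)) has_vector_derivative \<phi> 1 (\<phi> t z) - \<phi> t z) (at t within {0..b})"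
        by (rule avg_flow_has_vector_derivative[OF z _ t]) simp
      ultimately have eq: "v * deriv (avg 1) (\<phi> t z) = \<phi> 1 (\<phi> t z) - \<phi> t z"
        using vector_derivative_unique_within_closed_interval[of 0 b t] False b t
        unfolding cbox_interval by simp
      have "((\<lambda>t. k (\<phi> t z)) has_vector_derivative v * (deriv (avg 1) (\<phi> t z) / (\<phi> 1 (\<phi> t z) - \<phi> t z)))
          (at t within {0..b})"
        using field_vector_diff_chain_within[OF v has_field_derivative_at_within[OF k'[OF p]]]
        by (simp add: o_def)
      then have "((\<lambda>t. k (\<phi> t z)) has_vector_derivative 1) (at t within {0..b})"
        using eq nz[OF p] by simp
      from has_vector_derivative_diff[OF this has_vector_derivative_of_real[OF DERIV_ident]]
      show ?thesis by simp
    qed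
    then have "k (\<phi> b z) - of_real b = k (\<phi> 0 z) - of_real 0"
      using b by (intro has_derivative_zero_unique[of "{0..b}" "\<lambda>t. k (\<phi> t z) - of_real t"])
        (auto simp: has_vector_derivative_def)
    then show ?thesis using flow_0[OF z] by (simp add: algebra_simps)
  qed (use z flow_0 in simp)
  moreover have "k holomorphic_on ball 0 1" using k' by (meson holomorphic_on_open open_ball)
  ultimately show ?thesis using that by blast
qed

end

section \<open>Invariant horocycles\<close>

lemma one_minus_cnj_mult_nonzero:
  assumes "cmod a \<le> 1" "cmod z < 1"
  shows "1 - cnj a * z \<noteq> 0"
proof
  assume "1 - cnj a * z = 0"
  then have "cmod (cnj a * z) = 1" by simp
  moreover have "cmod a * cmod z \<le> 1 * cmod z" using assms by (intro mult_right_mono) auto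
  ultimately show False using assms by (simp add: norm_mult)
qed

lemma one_minus_norm_Moebius:
  assumes "cmod a < 1" "cmod z < 1"
  shows "1 - (cmod (Moebius_function 0 a z))\<^sup>2 =
    (1 - (cmod a)\<^sup>2) * ((1 - (cmod z)\<^sup>2) / (cmod (1 - cnj a * z))\<^sup>2)"
proof -
  have nz: "(cmod (1 - cnj a * z))\<^sup>2 \<noteq> 0" using one_minus_cnj_mult_nonzero[of a z] assms by simp
  have "(cmod (1 - cnj a * z))\<^sup>2 - (cmod (z - a))\<^sup>2 = (1 - (cmod a)\<^sup>2) * (1 - (cmod z)\<^sup>2)"
    unfolding cmod_power2 by (simp add: power2_eq_square algebra_simps)
  then show ?thesis
    using nz by (simp add: Moebius_function_simple norm_divide power_divide diff_divide_eq_iff divide_simps)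
qed

text \<open>Moebius conjugation moves the fixed point to \<open>0\<close>, where the Schwarz lemma
  applies. The factor \<open>1 - |a|^2\<close> is common to both sides; once it is cancelled, the
  inequality has a meaningful limit as \<open>a\<close> tends to the unit circle.\<close>

lemma Schwarz_Pick_fixed_point:
  assumes f: "f holomorphic_on ball 0 1" "f ` ball 0 1 \<subseteq> ball 0 1"
    and a: "cmod a < 1" "f a = a" and z: "cmod z < 1"
  shows "(1 - (cmod z)\<^sup>2) / (cmod (1 - cnj a * z))\<^sup>2 \<le> (1 - (cmod (f z))\<^sup>2) / (cmod (1 - cnj a * f z))\<^sup>2"
proof -
  define g where "g = Moebius_function 0 a \<circ> (f \<circ> Moebius_function 0 (- a))"
  have M: "Moebius_function 0 b holomorphic_on ball 0 1" 
    "Moebius_function 0 b ` ball 0 1 \<subseteq> ball 0 1" if "cmod b < 1" for b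
    using that Moebius_function_norm_lt_1 by (auto intro: Moebius_function_holomorphic)
  have ma: "cmod (- a) < 1" using a by simp
  have "g holomorphic_on ball 0 1"
    unfolding g_def using M[OF a(1)] M[OF ma] f
    by (intro holomorphic_on_compose_gen[where t = "ball 0 1"]) (auto simp: image_subset_iff)
  moreover have "g 0 = 0"
    using a by (simp add: g_def Moebius_function_of_zero Moebius_function_eq_zero)
  moreover have "cmod (g w) < 1" if "cmod w < 1" for w
    using that M[OF a(1)] M[OF ma] f by (auto simp: g_def image_subset_iff)
  moreover have fz: "cmod (f z) < 1" using f z by (auto simp: image_subset_iff)
  ultimately have "cmod (g (Moebius_function 0 a z)) \<le> cmod (Moebius_function 0 a z)"
    by (intro Schwarz_Lemma(1)) (use Moebius_function_norm_lt_1[OF a(1) z] in auto)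
  moreover have "Moebius_function 0 (- a) (Moebius_function 0 a z) = z"
    using Moebius_function_compose[of "- a" a z] a z by simp
  ultimately have "cmod (Moebius_function 0 a (f z)) \<le> cmod (Moebius_function 0 a z)"
    by (simp add: g_def)
  then have "(cmod (Moebius_function 0 a (f z)))\<^sup>2 \<le> (cmod (Moebius_function 0 a z))\<^sup>2"
    by (simp add: power_mono)
  then have "(1 - (cmod a)\<^sup>2) * ((1 - (cmod z)\<^sup>2) / (cmod (1 - cnj a * z))\<^sup>2)
      \<le> (1 - (cmod a)\<^sup>2) * ((1 - (cmod (f z))\<^sup>2) / (cmod (1 - cnj a * f z))\<^sup>2)"
    unfolding one_minus_norm_Moebius[OF a(1) z, symmetric] one_minus_norm_Moebius[OF a(1) fz, symmetric]
    by linarith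
  moreover have "0 < 1 - (cmod a)\<^sup>2" using a(1) by (simp add: power_less_one_iff abs_square_less_1)
  ultimately show ?thesis by (rule mult_left_le_imp_le)
qed

definition cayley :: "complex \<Rightarrow> complex \<Rightarrow> complex" where
  "cayley \<tau> z = (\<tau> + z) / (\<tau> - z)"

text \<open>The right-hand side is the Poisson kernel with pole \<open>\<tau>\<close>, whose level
  sets are the horocycles at \<open>\<tau>\<close>. It is also the limit of the quantity in
  \<open>Schwarz_Pick_fixed_point\<close> as \<open>a\<close> tends to
  \<open>\<tau>\<close>.\<close>

lemma Re_cayley:
  assumes "cmod \<tau> = 1"
  shows "Re (cayley \<tau> z) = (1 - (cmod z)\<^sup>2) / (cmod (1 - cnj \<tau> * z))\<^sup>2"
proof -
  have "cmod (\<tau> - z) = cmod (\<tau> * (1 - cnj \<tau> * z))"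
    using assms by (simp add: right_diff_distrib complex_norm_square[symmetric] flip: mult.assoc)
  then have d: "cmod (1 - cnj \<tau> * z) = cmod (\<tau> - z)" using assms by (simp add: norm_mult)
  have "Re (cayley \<tau> z) = ((cmod \<tau>)\<^sup>2 - (cmod z)\<^sup>2) / (cmod (\<tau> - z))\<^sup>2"
    unfolding cayley_def Re_divide cmod_power2 by (simp add: power2_eq_square algebra_simps)
  then show ?thesis using assms d by simp
qed

text \<open>The damped maps \<open>c n * f\<close> have fixed points by Brouwer. These cannot
  accumulate inside the disc, since a limit there would be fixed by \<open>f\<close>; at a boundary
  limit the Schwarz-Pick inequalities become invariance of horodiscs.\<close>

lemma Wolff:
  assumes f: "f holomorphic_on ball 0 1" "f ` ball 0 1 \<subseteq> ball 0 1"
    and nofix: "\<And>z. z \<in> ball 0 1 \<Longrightarrow> f z \<noteq> z"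
  obtains \<tau> where "cmod \<tau> = 1" "\<And>z. z \<in> ball 0 1 \<Longrightarrow> Re (cayley \<tau> z) \<le> Re (cayley \<tau> (f z))"
proof -
  \<comment> \<open>With \<open>n + 2\<close> even \<open>c 0\<close> is positive, as required for
    the radius of the ball in Brouwer's theorem.\<close>
  define c where "c n = 1 - 1 / real (n + 2)" for n
  have c: "0 < c n" "c n < 1" for n by (simp_all add: c_def)
  have c_lim: "c \<longlonglongrightarrow> 1"
  proof -
    have "(\<lambda>n. 1 - 1 / real (n + 2)) \<longlonglongrightarrow> 1 - 0"
      by (intro tendsto_diff tendsto_const LIMSEQ_ignore_initial_segment[OF lim_1_over_n])
    then show ?thesis by (simp add: c_def[abs_def])
  qed
  have fz: "cmod (f z) < 1" if "cmod z < 1" for z using f(2) that by (auto simp: image_subset_iff)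
  have cont: "continuous_on (ball 0 1) f" using f(1) holomorphic_on_imp_continuous_on by blast
  have "\<exists>a. cmod a \<le> c n \<and> of_real (c n) * f a = a" for n
  proof -
    have "cball 0 (c n) \<subseteq> ball 0 1" using c[of n] by auto
    then have "continuous_on (cball 0 (c n)) (\<lambda>z. of_real (c n) * f z)"
      using cont by (intro continuous_intros) (rule continuous_on_subset)
    moreover have "(\<lambda>z. of_real (c n) * f z) \<in> cball 0 (c n) \<rightarrow> cball 0 (c n)"
      using c[of n] fz by (force simp: norm_mult intro: mult_left_le less_imp_le)
    ultimately show ?thesis using brouwer_ball[OF c(1)[of n]] by (metis mem_cball_0)
  qed
  then obtain a where a: "\<And>n. cmod (a n) \<le> c n" "\<And>n. of_real (c n) * f (a n) = a n" by metis
  have a1: "cmod (a n) < 1" for n using a(1)[of n] c(2)[of n] by simp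
  have "\<forall>n. a n \<in> cball 0 1" using a1 less_imp_le by auto
  then obtain \<tau> r where \<tau>: "\<tau> \<in> cball 0 1" and r: "strict_mono r" and lim: "(a \<circ> r) \<longlonglongrightarrow> \<tau>"
    using compact_cball[unfolded compact_def, of "0::complex" 1] by blast
  have al: "(\<lambda>n. a (r n)) \<longlonglongrightarrow> \<tau>" using lim by (simp add: o_def)
  have cl: "(\<lambda>n. of_real (c (r n))) \<longlonglongrightarrow> (1::complex)"
    using tendsto_of_real[OF LIMSEQ_subseq_LIMSEQ[OF c_lim r]] by (simp add: o_def)
  have n\<tau>: "cmod \<tau> = 1"
  proof (rule ccontr)
    assume "cmod \<tau> \<noteq> 1"
    then have \<tau>1: "\<tau> \<in> ball 0 1" using \<tau> by simp
    have "(\<lambda>n. f (a (r n))) \<longlonglongrightarrow> f \<tau>"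
      using \<tau>1 a1 by (intro continuous_on_tendsto_compose[OF cont al]) auto
    from tendsto_mult[OF cl this] have "(\<lambda>n. a (r n)) \<longlonglongrightarrow> 1 * f \<tau>" by (simp add: a(2))
    then have "f \<tau> = \<tau>" using al LIMSEQ_unique by auto
    then show False using nofix \<tau>1 by blast
  qed
  have "Re (cayley \<tau> z) \<le> Re (cayley \<tau> (f z))" if "z \<in> ball 0 1" for z
  proof -
    have z: "cmod z < 1" using that by simp
    have ineq: "(1 - (cmod z)\<^sup>2) / (cmod (1 - cnj (a n) * z))\<^sup>2 \<le>
        (1 - (cmod (of_real (c n) * f z))\<^sup>2) / (cmod (1 - cnj (a n) * (of_real (c n) * f z)))\<^sup>2" for n
    proof (rule Schwarz_Pick_fixed_point[where f = "\<lambda>z. of_real (c n) * f z"])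
      show "(\<lambda>z. of_real (c n) * f z) holomorphic_on ball 0 1" by (intro holomorphic_intros f)
      show "(\<lambda>z. of_real (c n) * f z) ` ball 0 1 \<subseteq> ball 0 1"
      proof safe
        fix w :: complex assume "w \<in> ball 0 1"
        then have "c n * cmod (f w) < 1 * 1"
          using c[of n] fz[of w] by (intro mult_strict_mono) auto
        then show "of_real (c n) * f w \<in> ball 0 1" using c[of n] by (simp add: norm_mult)
      qed
    qed (use a1 a(2) z in auto)
    have "1 - cnj \<tau> * z \<noteq> 0" "1 - cnj \<tau> * (1 * f z) \<noteq> 0"
      using one_minus_cnj_mult_nonzero n\<tau> z fz[OF z] by auto
    then have "(\<lambda>n. (1 - (cmod z)\<^sup>2) / (cmod (1 - cnj (a (r n)) * z))\<^sup>2) \<longlonglongrightarrow>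
        (1 - (cmod z)\<^sup>2) / (cmod (1 - cnj \<tau> * z))\<^sup>2"
      and "(\<lambda>n. (1 - (cmod (of_real (c (r n)) * f z))\<^sup>2) / (cmod (1 - cnj (a (r n)) * (of_real (c (r n)) * f z)))\<^sup>2) \<longlonglongrightarrow>
        (1 - (cmod (1 * f z))\<^sup>2) / (cmod (1 - cnj \<tau> * (1 * f z)))\<^sup>2"
      by (intro tendsto_intros al cl; simp)+
    then have "(1 - (cmod z)\<^sup>2) / (cmod (1 - cnj \<tau> * z))\<^sup>2 \<le> (1 - (cmod (1 * f z))\<^sup>2) / (cmod (1 - cnj \<tau> * (1 * f z)))\<^sup>2"
      using ineq by (intro LIMSEQ_le) auto
    then show ?thesis using Re_cayley[OF n\<tau>] by simp
  qed
  with n\<tau> that show ?thesis by blast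
qed

lemma continuous_on_Re_cayley:
  assumes "continuous_on A f" "continuous_on A g" "\<And>x. x \<in> A \<Longrightarrow> f x \<noteq> g x"
  shows "continuous_on A (\<lambda>x. Re (cayley (f x) (g x)))"
  unfolding cayley_def using assms by (intro continuous_intros) auto

section \<open>A boundary point common to all times\<close>

context disc_flow begin

lemma horocycle_mult:
  assumes "\<And>z. z \<in> ball 0 1 \<Longrightarrow> Re (cayley \<tau> z) \<le> Re (cayley \<tau> (\<phi> s z))" "0 \<le> s" "z \<in> ball 0 1"
  shows "Re (cayley \<tau> z) \<le> Re (cayley \<tau> (\<phi> (real m * s) z))"
proof (induction m)
  case (Suc m)
  have "\<phi> (real (Suc m) * s) z = \<phi> s (\<phi> (real m * s) z)"
    using flow_add[of s "real m * s" z] assms by (simp add: algebra_simps)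
  moreover have "Re (cayley \<tau> (\<phi> (real m * s) z)) \<le> Re (cayley \<tau> (\<phi> s (\<phi> (real m * s) z)))"
    using assms by (intro assms(1) flow_in_ball) auto
  ultimately show ?case using Suc by simp
qed (use assms flow_0 in auto)

text \<open>Let \<open>K n\<close> collect the boundary points whose horodiscs are invariant at time
  \<open>1 / 2 ^ n\<close>. These sets are compact and nonempty, and they decrease because each time
  step is twice the next. A point of the intersection serves all dyadic times, hence by continuity
  all times.\<close>

lemma common_horocycle_point:
  assumes ne: "non_elliptic \<phi>"
  obtains \<tau> where "cmod \<tau> = 1"
    "\<And>z t. z \<in> ball 0 1 \<Longrightarrow> 0 \<le> t \<Longrightarrow> Re (cayley \<tau> z) \<le> Re (cayley \<tau> (\<phi> t z))"
proof -
  define s :: "nat \<Rightarrow> real" where "s n = 1 / 2 ^ n" for n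
  have s: "0 < s n" for n by (simp add: s_def)
  define K where "K n = {\<tau> \<in> sphere 0 1. \<forall>z\<in>ball 0 1. Re (cayley \<tau> z) \<le> Re (cayley \<tau> (\<phi> (s n) z))}" for n
  have "\<Inter> (range K) \<noteq> {}"
  proof (rule compact_nest)
    show "compact (K n)" for n
    proof -
      have "closed {\<tau> \<in> sphere 0 1. Re (cayley \<tau> z) \<le> Re (cayley \<tau> (\<phi> (s n) z))}" if "z \<in> ball 0 1" for z
        using that flow_in_ball[of "s n" z] s[of n]
        by (intro continuous_on_closed_Collect_le continuous_on_Re_cayley continuous_intros) (auto simp: less_imp_le)
      then have "closed (\<Inter>z\<in>ball 0 1. {\<tau> \<in> sphere 0 1. Re (cayley \<tau> z) \<le> Re (cayley \<tau> (\<phi> (s n) z))})"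
        by blast
      moreover have "K n = sphere 0 1 \<inter> (\<Inter>z\<in>ball 0 1. {\<tau> \<in> sphere 0 1. Re (cayley \<tau> z) \<le> Re (cayley \<tau> (\<phi> (s n) z))})"
        by (auto simp: K_def)
      ultimately show ?thesis by (simp add: compact_Int_closed)
    qed
    show "K n \<noteq> {}" for n
    proof -
      obtain \<tau> where "cmod \<tau> = 1" "\<And>z. z \<in> ball 0 1 \<Longrightarrow> Re (cayley \<tau> z) \<le> Re (cayley \<tau> (\<phi> (s n) z))"
      proof (rule Wolff[of "\<phi> (s n)"])
        show "\<phi> (s n) z \<noteq> z" if "z \<in> ball 0 1" for z
          using ne s[of n] that by (simp add: non_elliptic_def)
      qed (use s[of n] flow_holomorphic flow_in_ball in auto)
      then have "\<tau> \<in> K n" by (simp add: K_def)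
      then show ?thesis by blast
    qed
    have "K (Suc n) \<subseteq> K n" for n
    proof
      fix \<tau> assume \<tau>: "\<tau> \<in> K (Suc n)"
      have "Re (cayley \<tau> z) \<le> Re (cayley \<tau> (\<phi> (s n) z))" if "z \<in> ball 0 1" for z
        using horocycle_mult[of \<tau> "s (Suc n)" z 2] \<tau> s[of "Suc n"] that by (simp add: K_def s_def)
      then show "\<tau> \<in> K n" using \<tau> by (simp add: K_def)
    qed
    then show "K n \<subseteq> K m" if "m \<le> n" for m n
      using that by (rule lift_Suc_antimono_le)
  qed
  then obtain \<tau> where \<tau>: "\<And>n. \<tau> \<in> K n" by blast
  have n\<tau>: "cmod \<tau> = 1" using \<tau>[of 0] by (simp add: K_def)
  have "Re (cayley \<tau> z) \<le> Re (cayley \<tau> (\<phi> t z))" if z: "z \<in> ball 0 1" and t: "0 \<le> t" for z t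
  proof -
    \<comment> \<open>The largest multiple of \<open>1 / 2 ^ n\<close> not exceeding
      \<open>t\<close>.\<close>
    define q where "q n = real (nat \<lfloor>t * 2 ^ n\<rfloor>) * s n" for n
    have q0: "0 \<le> q n" for n using s[of n] by (simp add: q_def)
    have q_le: "t - s n \<le> q n" "q n \<le> t" for n
    proof -
      have "real (nat \<lfloor>t * 2 ^ n\<rfloor>) = of_int \<lfloor>t * 2 ^ n\<rfloor>" using t by simp
      then have "t * 2 ^ n - 1 \<le> real (nat \<lfloor>t * 2 ^ n\<rfloor>)" "real (nat \<lfloor>t * 2 ^ n\<rfloor>) \<le> t * 2 ^ n"
        by linarith+
      then have "(t * 2 ^ n - 1) / 2 ^ n \<le> real (nat \<lfloor>t * 2 ^ n\<rfloor>) / 2 ^ n"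
          "real (nat \<lfloor>t * 2 ^ n\<rfloor>) / 2 ^ n \<le> t * 2 ^ n / 2 ^ n"
        by (intro divide_right_mono; simp)+
      moreover have "q n = real (nat \<lfloor>t * 2 ^ n\<rfloor>) / 2 ^ n" by (simp add: q_def s_def)
      ultimately show "t - s n \<le> q n" "q n \<le> t" by (simp_all add: s_def diff_divide_distrib)
    qed
    have "s \<longlonglongrightarrow> 0"
      unfolding s_def[abs_def] using LIMSEQ_divide_realpow_zero[of 2 1] by simp
    then have "(\<lambda>n. t - s n) \<longlonglongrightarrow> t - 0" by (intro tendsto_intros)
    then have lim: "(\<lambda>n. t - s n) \<longlonglongrightarrow> t" by simp
    have "q \<longlonglongrightarrow> t"
      by (rule tendsto_sandwich[OF _ _ lim tendsto_const]) (simp_all add: q_le)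
    then have "(\<lambda>n. \<phi> (q n) z) \<longlonglongrightarrow> \<phi> t z"
      using q0 t by (intro continuous_on_tendsto_compose[OF flow_continuous[OF z]]) auto
    moreover have "\<tau> - \<phi> t z \<noteq> 0" using flow_in_ball[OF t z] n\<tau> by auto
    ultimately have "(\<lambda>n. Re (cayley \<tau> (\<phi> (q n) z))) \<longlonglongrightarrow> Re (cayley \<tau> (\<phi> t z))"
      unfolding cayley_def by (intro tendsto_intros)
    moreover have "Re (cayley \<tau> z) \<le> Re (cayley \<tau> (\<phi> (q n) z))" for n
      unfolding q_def using \<tau>[of n] s[of n] z by (intro horocycle_mult) (auto simp: K_def)
    ultimately show ?thesis using LIMSEQ_le_const by blast
  qed
  with n\<tau> that show ?thesis by blast
qed

end

section \<open>The orthogonal speed in the half-plane model\<close>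

definition inv_cayley :: "complex \<Rightarrow> complex \<Rightarrow> complex" where
  "inv_cayley \<tau> w = \<tau> * (w - 1) / (w + 1)"

lemma add_of_real_nonzero: "0 < Re w \<Longrightarrow> 0 \<le> x \<Longrightarrow> w + of_real x \<noteq> 0"
  by (auto simp: complex_eq_iff)

lemma cmod_minus_square: "(cmod (w - of_real x))\<^sup>2 = (cmod w)\<^sup>2 + x\<^sup>2 - 2 * x * Re w"
  and cmod_plus_square: "(cmod (w + of_real x))\<^sup>2 = (cmod w)\<^sup>2 + x\<^sup>2 + 2 * x * Re w"
  unfolding cmod_power2 by (simp_all add: power2_eq_square algebra_simps)

lemma cmod_minus_less_plus:
  assumes "0 < Re w" "0 < x"
  shows "cmod (w - of_real x) < cmod (w + of_real x)"
proof (rule power2_less_imp_less)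
  have "0 < x * Re w" using assms by simp
  then show "(cmod (w - of_real x))\<^sup>2 < (cmod (w + of_real x))\<^sup>2"
    unfolding cmod_minus_square cmod_plus_square by linarith
qed simp

lemma inv_cayley_in_ball:
  assumes "cmod \<tau> = 1" "0 < Re w"
  shows "inv_cayley \<tau> w \<in> ball 0 1"
  using cmod_minus_less_plus[of w 1] add_of_real_nonzero[of w 1] assms
  by (simp add: inv_cayley_def norm_mult norm_divide)

lemma cayley_inv_cayley:
  assumes "cmod \<tau> = 1" "0 < Re w"
  shows "cayley \<tau> (inv_cayley \<tau> w) = w"
proof -
  have nz: "w + 1 \<noteq> 0" "\<tau> \<noteq> 0" using add_of_real_nonzero[of w 1] assms by auto
  have "\<tau> + inv_cayley \<tau> w = 2 * \<tau> * w / (w + 1)" "\<tau> - inv_cayley \<tau> w = 2 * \<tau> / (w + 1)"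
    using nz by (simp_all add: inv_cayley_def field_simps)
  then show ?thesis using nz by (simp add: cayley_def)
qed

lemma inv_cayley_cayley:
  assumes "cmod \<tau> = 1" "z \<in> ball 0 1"
  shows "inv_cayley \<tau> (cayley \<tau> z) = z"
proof -
  have nz: "\<tau> - z \<noteq> 0" "\<tau> \<noteq> 0" using assms by auto
  have "cayley \<tau> z - 1 = 2 * z / (\<tau> - z)" "cayley \<tau> z + 1 = 2 * \<tau> / (\<tau> - z)"
    using nz by (simp_all add: cayley_def field_simps)
  then show ?thesis using nz by (simp add: inv_cayley_def)
qed

lemma Re_cayley_pos: "cmod \<tau> = 1 \<Longrightarrow> z \<in> ball 0 1 \<Longrightarrow> 0 < Re (cayley \<tau> z)"
  using one_minus_cnj_mult_nonzero[of \<tau> z] by (simp add: Re_cayley abs_square_less_1)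

lemma inv_cayley_holomorphic: "inv_cayley \<tau> holomorphic_on {w. 0 < Re w}"
  unfolding inv_cayley_def[abs_def]
  using add_of_real_nonzero[of _ 1] by (intro holomorphic_intros) auto

lemma diameter_to_eq: "diameter_to \<tau> = (\<lambda>x. inv_cayley \<tau> (of_real x)) ` {0<..}"
proof -
  have 1: "of_real r * \<tau> = inv_cayley \<tau> (of_real ((1 + r) / (1 - r)))" "0 < (1 + r) / (1 - r)"
    if "- 1 < r" "r < 1" for r
  proof -
    have nz: "1 - complex_of_real r \<noteq> 0" using that by (simp add: complex_eq_iff)
    then have "of_real ((1 + r) / (1 - r)) - 1 = 2 * complex_of_real r / (1 - of_real r)"
      "of_real ((1 + r) / (1 - r)) + 1 = (2 :: complex) / (1 - of_real r)"
      by (simp_all add: field_simps)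
    then show "of_real r * \<tau> = inv_cayley \<tau> (of_real ((1 + r) / (1 - r)))"
      using nz by (simp add: inv_cayley_def)
    show "0 < (1 + r) / (1 - r)" using that by simp
  qed
  have 2: "inv_cayley \<tau> (of_real x) = of_real ((x - 1) / (x + 1)) * \<tau>"
    "- 1 < (x - 1) / (x + 1)" "(x - 1) / (x + 1) < 1" if "0 < x" for x
    using that by (simp_all add: inv_cayley_def field_simps)
  show ?thesis
  proof (intro equalityI subsetI)
    show "p \<in> (\<lambda>x. inv_cayley \<tau> (of_real x)) ` {0<..}" if p: "p \<in> diameter_to \<tau>" for p
    proof -
      obtain r where r: "p = of_real r * \<tau>" "- 1 < r" "r < 1" using p by (auto simp: diameter_to_def)
      show ?thesis using 1(1)[OF r(2,3)] 1(2)[OF r(2,3)] r(1) by (intro image_eqI) auto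
    qed
    show "p \<in> diameter_to \<tau>" if "p \<in> (\<lambda>x. inv_cayley \<tau> (of_real x)) ` {0<..}" for p
      using that 2 unfolding diameter_to_def by blast
  qed
qed

lemma artanh_strict_mono:
  fixes u v :: real
  assumes "0 \<le> u" "u < v" "v < 1"
  shows "artanh u < artanh v"
proof -
  have "(1 + u) / (1 - u) < (1 + v) / (1 - v)" using assms by (intro frac_less) auto
  moreover have "0 < (1 + u) / (1 - u)" using assms by simp
  ultimately have "ln ((1 + u) / (1 - u)) < ln ((1 + v) / (1 - v))" by (rule ln_strict_mono)
  then show ?thesis unfolding artanh_def by linarith
qed

text \<open>The Cayley map is an isometry, and the pseudo-hyperbolic distance of the half-plane is
  \<open>|w - x| / |w + cnj x|\<close>; here \<open>x\<close> is real.\<close>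

lemma hyp_dist_cayley:
  assumes \<tau>: "cmod \<tau> = 1" and z: "z \<in> ball 0 1" and x: "0 < x"
  shows "hyp_dist z (inv_cayley \<tau> (of_real x)) =
    artanh (cmod (cayley \<tau> z - of_real x) / cmod (cayley \<tau> z + of_real x))"
proof -
  define w where "w = cayley \<tau> z"
  have w: "0 < Re w" using Re_cayley_pos[OF \<tau> z] by (simp add: w_def)
  have z_eq: "z = \<tau> * (w - 1) / (w + 1)"
    using inv_cayley_cayley[OF \<tau> z] by (simp add: w_def inv_cayley_def)
  have nz: "w + 1 \<noteq> 0" "w + of_real x \<noteq> 0" "of_real x + 1 \<noteq> (0::complex)"
    using add_of_real_nonzero[of w 1] add_of_real_nonzero[of w x] w x
      add_of_real_nonzero[of "of_real x" 1] by auto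
  define p where "p = inv_cayley \<tau> (of_real x)"
  have tt: "\<tau> * cnj \<tau> = 1" using \<tau> by (simp add: complex_norm_square[symmetric])
  define X :: complex where "X = of_real x"
  have nzX: "X + 1 \<noteq> 0" "w + X \<noteq> 0" using nz by (simp_all add: X_def)
  have p1: "z - p = \<tau> * 2 * (w - X) / ((w + 1) * (X + 1))"
  proof -
    have "\<tau> * (w - 1) * (X + 1) - \<tau> * (X - 1) * (w + 1) = \<tau> * 2 * (w - X)"
      by (simp add: algebra_simps)
    then show ?thesis
      unfolding z_eq p_def inv_cayley_def X_def[symmetric] diff_frac_eq[OF nz(1) nzX(1)] by (simp only:)
  qed
  have "z * cnj p = (\<tau> * cnj \<tau>) * ((w - 1) * (X - 1)) / ((w + 1) * (X + 1))"
    unfolding z_eq p_def inv_cayley_def by (simp add: mult_ac X_def)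
  then have "1 - z * cnj p = 1 - (w - 1) * (X - 1) / ((w + 1) * (X + 1))"
    by (simp only: tt mult_1_left)
  also have "\<dots> = ((w + 1) * (X + 1) - (w - 1) * (X - 1)) / ((w + 1) * (X + 1))"
    using nz(1) nzX(1) by (simp add: diff_divide_distrib)
  also have "(w + 1) * (X + 1) - (w - 1) * (X - 1) = 2 * (w + X)"
    by (simp add: algebra_simps)
  finally have p2: "1 - z * cnj p = 2 * (w + X) / ((w + 1) * (X + 1))" .
  have "(z - p) / (1 - z * cnj p) = \<tau> * (w - X) / (w + X)"
    unfolding p1 p2 using nz(1) nzX by (simp del: distrib_left_numeral)
  then have "cmod ((z - p) / (1 - z * cnj p)) = cmod (w - of_real x) / cmod (w + of_real x)"
    using \<tau> by (simp add: norm_mult norm_divide X_def)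
  then show ?thesis unfolding hyp_dist_def Let_def artanh_def p_def w_def by simp
qed

lemma ratio_less_1: "0 < Re w \<Longrightarrow> 0 < x \<Longrightarrow> cmod (w - of_real x) / cmod (w + of_real x) < 1"
  using cmod_minus_less_plus[of w x] by (simp add: divide_less_eq)

text \<open>The geodesic through \<open>w\<close> orthogonal to the positive axis is the half-circle
  of radius \<open>|w|\<close> about \<open>0\<close>, so the foot is \<open>|w|\<close>.
  Algebraically, the difference of the squared cross products is a positive multiple of
  \<open>(m - x)^2\<close>, which also gives uniqueness of the minimum.\<close>

lemma ratio_min:
  assumes w: "0 < Re w" and x: "0 < x" "x \<noteq> cmod w"
  shows "cmod (w - of_real (cmod w)) / cmod (w + of_real (cmod w)) < cmod (w - of_real x) / cmod (w + of_real x)"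
proof -
  define m where "m = cmod w"
  have m: "0 < m" using w by (auto simp: m_def)
  have pos: "0 < cmod (w + of_real y)" if "0 < y" for y using add_of_real_nonzero[of w y] w that by simp
  have "(cmod (w - of_real x))\<^sup>2 * (cmod (w + of_real m))\<^sup>2 - (cmod (w - of_real m))\<^sup>2 * (cmod (w + of_real x))\<^sup>2
      = 4 * m * Re w * (m - x)\<^sup>2"
    unfolding cmod_minus_square cmod_plus_square m_def[symmetric]
    by (simp add: power2_eq_square algebra_simps)
  moreover have "0 < 4 * m * Re w * (m - x)\<^sup>2" using m w x by (simp add: m_def)
  ultimately have "(cmod (w - of_real m) * cmod (w + of_real x))\<^sup>2 < (cmod (w - of_real x) * cmod (w + of_real m))\<^sup>2"
    unfolding power_mult_distrib by linarith
  then have "cmod (w - of_real m) * cmod (w + of_real x) < cmod (w - of_real x) * cmod (w + of_real m)"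
    by (rule power2_less_imp_less) simp
  then show ?thesis using pos[OF m] pos[OF x(1)] by (simp add: m_def[symmetric] frac_less_eq divide_simps mult.commute)
qed

lemma hyp_proj_eq:
  assumes \<tau>: "cmod \<tau> = 1" and z: "z \<in> ball 0 1"
  shows "hyp_proj \<tau> z = inv_cayley \<tau> (of_real (cmod (cayley \<tau> z)))"
proof -
  define w where "w = cayley \<tau> z"
  have w: "0 < Re w" using Re_cayley_pos[OF \<tau> z] by (simp add: w_def)
  then have m: "0 < cmod w" by auto
  have less: "hyp_dist z (inv_cayley \<tau> (of_real (cmod w))) < hyp_dist z (inv_cayley \<tau> (of_real x))"
    if "0 < x" "x \<noteq> cmod w" for x
    unfolding hyp_dist_cayley[OF \<tau> z m] hyp_dist_cayley[OF \<tau> z that(1)] w_def[symmetric]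
    using ratio_min[OF w that] ratio_less_1[OF w that(1)] by (intro artanh_strict_mono) auto
  show ?thesis
    unfolding hyp_proj_def w_def[symmetric] diameter_to_eq
  proof (rule the_equality)
    show "inv_cayley \<tau> (of_real (cmod w)) \<in> (\<lambda>x. inv_cayley \<tau> (of_real x)) ` {0<..} \<and>
      (\<forall>q\<in>(\<lambda>x. inv_cayley \<tau> (of_real x)) ` {0<..}. hyp_dist z (inv_cayley \<tau> (of_real (cmod w))) \<le> hyp_dist z q)"
    proof (intro conjI ballI)
      show "inv_cayley \<tau> (of_real (cmod w)) \<in> (\<lambda>x. inv_cayley \<tau> (of_real x)) ` {0<..}"
        using m by blast
      show "hyp_dist z (inv_cayley \<tau> (of_real (cmod w))) \<le> hyp_dist z q"
        if q: "q \<in> (\<lambda>x. inv_cayley \<tau> (of_real x)) ` {0<..}" for q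
      proof -
        obtain x where "0 < x" "q = inv_cayley \<tau> (of_real x)" using q by auto
        then show ?thesis using less[of x] by (cases "x = cmod w") auto
      qed
    qed
    fix p assume p: "p \<in> (\<lambda>x. inv_cayley \<tau> (of_real x)) ` {0<..} \<and>
      (\<forall>q\<in>(\<lambda>x. inv_cayley \<tau> (of_real x)) ` {0<..}. hyp_dist z p \<le> hyp_dist z q)"
    then obtain x where x: "0 < x" "p = inv_cayley \<tau> (of_real x)" by auto
    have "hyp_dist z p \<le> hyp_dist z (inv_cayley \<tau> (of_real (cmod w)))" using p m by auto
    then have "x = cmod w" using less[of x] x by (auto simp: not_less[symmetric])
    then show "p = inv_cayley \<tau> (of_real (cmod w))" using x by simp
  qed
qed

text \<open>The bound \<open>1 \<le> |w|\<close> fixes the sign: in general the distance from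
  \<open>1\<close> to \<open>m\<close> on the positive axis is half of
  \<open>|ln m|\<close>.\<close>

lemma hyp_dist_0_hyp_proj:
  assumes \<tau>: "cmod \<tau> = 1" and z: "z \<in> ball 0 1" and m: "1 \<le> cmod (cayley \<tau> z)"
  shows "hyp_dist 0 (hyp_proj \<tau> z) = 1 / 2 * ln (cmod (cayley \<tau> z))"
proof -
  define m where "m = cmod (cayley \<tau> z)"
  have m: "1 \<le> m" using assms by (simp add: m_def)
  have [simp]: "cayley \<tau> 0 = 1" using \<tau> by (auto simp: cayley_def)
  have "cmod (1 - of_real m) = m - 1" "cmod (1 + of_real m) = m + 1"
    using m norm_of_real[of "1 - m", where 'a = complex] norm_of_real[of "1 + m", where 'a = complex] by simp_all
  then have "hyp_dist 0 (hyp_proj \<tau> z) = artanh ((m - 1) / (m + 1))"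
    using hyp_dist_cayley[OF \<tau>, of 0 m] m by (simp add: hyp_proj_eq[OF \<tau> z] m_def[symmetric])
  also have "(1 + (m - 1) / (m + 1)) / (1 - (m - 1) / (m + 1)) = m"
    using m by (simp add: field_simps)
  then have "artanh ((m - 1) / (m + 1)) = 1 / 2 * ln m" by (simp add: artanh_def)
  finally show ?thesis by (simp add: m_def)
qed

section \<open>The flow in half-plane coordinates\<close>

lemma Re_nonneg_imp_pos_or_constant:
  assumes f: "f holomorphic_on S" "open S" "connected S" "\<And>z. z \<in> S \<Longrightarrow> 0 \<le> Re (f z)"
  shows "(\<forall>z\<in>S. 0 < Re (f z)) \<or> f constant_on S"
proof (rule ccontr)
  assume "\<not> ?thesis"
  then obtain z where z: "z \<in> S" "Re (f z) = 0" and nc: "\<not> f constant_on S"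
    using f(4) by fastforce
  \<comment> \<open>An open image touching the imaginary axis would contain values with negative
    real part.\<close>
  have "open (f ` S)" using f nc by (intro open_mapping_thm[of f S S]) auto
  then obtain e where e: "0 < e" "ball (f z) e \<subseteq> f ` S" using z open_contains_ball by blast
  have "f z - of_real (e / 2) \<in> ball (f z) e" using e by (simp add: dist_norm)
  then obtain x where "x \<in> S" "f x = f z - of_real (e / 2)" using e by (metis imageE subsetD)
  then show False using f(4)[of x] z e by simp
qed

lemma has_vector_derivative_Re_nonneg:
  assumes "(f has_vector_derivative v) (at 0 within {0..1})" "\<And>t. 0 < t \<Longrightarrow> t \<le> 1 \<Longrightarrow> Re (f 0) \<le> Re (f t)"
  shows "0 \<le> Re v"
proof (rule ccontr)
  assume neg: "\<not> 0 \<le> Re v"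
  have "((\<lambda>t. Re (f t)) has_real_derivative Re v) (at 0 within {0..1})"
    using bounded_linear.has_vector_derivative[OF bounded_linear_Re assms(1)]
    by (simp add: has_real_derivative_iff_has_vector_derivative)
  then obtain d where d: "0 < d" "\<And>t. 0 < t \<Longrightarrow> 0 + t \<in> {0..1} \<Longrightarrow> t < d \<Longrightarrow> Re (f (0 + t)) < Re (f 0)"
    using has_real_derivative_neg_dec_right[of "\<lambda>t. Re (f t)" "Re v" 0 "{0..1}"] neg by force
  define t where "t = min 1 (d / 2)"
  have "0 < t" "t \<le> 1" "t < d" using d(1) by (auto simp: t_def min_def)
  with assms(2)[of t] d(2)[of t] show False by simp
qed

text \<open>Here \<open>\<tau>\<close> is only known to have invariant horodiscs;
  \<open>denjoy_wolff_point_eq\<close> identifies it. The map \<open>h\<close> is the Koenigs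
  function carried over to the half-plane.\<close>

locale non_elliptic_flow = disc_flow +
  fixes \<tau> :: complex and h :: "complex \<Rightarrow> complex"
  assumes \<tau>: "cmod \<tau> = 1"
    and Re_cayley_flow: "z \<in> ball 0 1 \<Longrightarrow> 0 \<le> t \<Longrightarrow> Re (cayley \<tau> z) \<le> Re (cayley \<tau> (\<phi> t z))"
    and h_holomorphic: "h holomorphic_on {w. 0 < Re w}"
    and h_flow: "z \<in> ball 0 1 \<Longrightarrow> 0 \<le> t \<Longrightarrow> h (cayley \<tau> (\<phi> t z)) = h (cayley \<tau> z) + of_real t"
begin

lemma cayley_0 [simp]: "cayley \<tau> 0 = 1"
  using \<tau> by (auto simp: cayley_def)

text \<open>Along the orbit \<open>h\<close> grows by \<open>t\<close>, while it is bounded on each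
  compact set \<open>{c \<le> Re w}\<close> intersected with a closed disc. Since the orbit stays in
  \<open>{c \<le> Re w}\<close>, it must go to infinity, which in the disc means to
  \<open>\<tau>\<close>.\<close>

lemma tendsto_flow: "z \<in> ball 0 1 \<Longrightarrow> ((\<lambda>t. \<phi> t z) \<longlongrightarrow> \<tau>) at_top"
proof -
  assume z: "z \<in> ball 0 1"
  define W where "W t = cayley \<tau> (\<phi> t z)" for t
  define c where "c = Re (cayley \<tau> z)"
  have c: "0 < c" using Re_cayley_pos[OF \<tau> z] by (simp add: c_def)
  have W_at_infinity: "filterlim W at_infinity at_top"
    unfolding filterlim_at_infinity[OF order_refl]
  proof (intro allI impI)
    fix R :: real assume "0 < R"
    define K where "K = {w. c \<le> Re w} \<inter> cball 0 R"
    have "compact K" unfolding K_def by (intro closed_Int_compact closed_halfspace_Re_ge compact_cball)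
    moreover have "K \<subseteq> {w. 0 < Re w}" using c by (auto simp: K_def)
    ultimately have "compact (h ` K)"
      using h_holomorphic by (intro compact_continuous_image)
        (auto intro: continuous_on_subset holomorphic_on_imp_continuous_on)
    then obtain M where M: "\<And>w. w \<in> K \<Longrightarrow> cmod (h w) \<le> M"
      using compact_imp_bounded bounded_iff by (metis imageI)
    show "\<forall>\<^sub>F t in at_top. R \<le> cmod (W t)"
      using eventually_gt_at_top[of "max 0 (M + cmod (h (cayley \<tau> z)))"]
    proof eventually_elim
      case (elim t)
      then have t: "0 \<le> t" by simp
      have "t - cmod (h (cayley \<tau> z)) \<le> cmod (h (W t))"
        using norm_diff_ineq[of "of_real t" "h (cayley \<tau> z)"] t
        by (simp add: W_def h_flow[OF z t] add.commute)
      then have "M < cmod (h (W t))" using elim by simp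
      then have "W t \<notin> K" using M[of "W t"] by auto
      moreover have "c \<le> Re (W t)" using Re_cayley_flow[OF z t] by (simp add: W_def c_def)
      ultimately show ?case by (simp add: K_def)
    qed
  qed
  have "filterlim (\<lambda>t. 1 + W t) at_infinity at_top"
    using W_at_infinity by (intro tendsto_add_filterlim_at_infinity[OF tendsto_const])
  then have "((\<lambda>t. 2 * \<tau> / (1 + W t)) \<longlongrightarrow> 0) at_top"
    by (rule tendsto_divide_0[OF tendsto_const])
  then have "((\<lambda>t. \<tau> - 2 * \<tau> / (1 + W t)) \<longlongrightarrow> \<tau> - 0) at_top"
    by (intro tendsto_intros)
  then have lim: "((\<lambda>t. \<tau> - 2 * \<tau> / (1 + W t)) \<longlongrightarrow> \<tau>) at_top" by simp
  have "\<forall>\<^sub>F t in at_top. \<tau> - 2 * \<tau> / (1 + W t) = \<phi> t z"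
    using eventually_ge_at_top[of 0]
  proof eventually_elim
    case (elim t)
    then have p: "\<phi> t z \<in> ball 0 1" using flow_in_ball z by blast
    have "1 + W t \<noteq> 0" using add_of_real_nonzero[OF Re_cayley_pos[OF \<tau> p], of 1] by (simp add: W_def add.commute)
    then have "\<tau> - 2 * \<tau> / (1 + W t) = inv_cayley \<tau> (W t)"
      by (simp add: inv_cayley_def field_simps)
    then show ?case using inv_cayley_cayley[OF \<tau> p] by (simp add: W_def)
  qed
  from this lim show ?thesis by (rule Lim_transform_eventually[rotated])
qed

lemma denjoy_wolff_point_eq: "denjoy_wolff_point \<phi> = \<tau>"
  unfolding denjoy_wolff_point_def
proof (rule the_equality)
  show "\<tau> \<in> sphere 0 1 \<and> (\<forall>z\<in>ball 0 1. ((\<lambda>t. \<phi> t z) \<longlongrightarrow> \<tau>) at_top)"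
    using \<tau> tendsto_flow by simp
  show "\<sigma> = \<tau>" if "\<sigma> \<in> sphere 0 1 \<and> (\<forall>z\<in>ball 0 1. ((\<lambda>t. \<phi> t z) \<longlongrightarrow> \<sigma>) at_top)" for \<sigma>
    using tendsto_unique[OF trivial_limit_at_top_linorder _ tendsto_flow[of 0], of \<sigma>] that by simp
qed

text \<open>Differentiating \<open>h (W t) = h w + t\<close> at \<open>0\<close> shows that
  \<open>deriv h w\<close> is the reciprocal of the velocity of \<open>W\<close>, whose real part is
  nonnegative because \<open>Re (W t)\<close> is never below its initial value.\<close>

lemma Re_deriv_h_nonneg:
  assumes w: "0 < Re w"
  shows "0 \<le> Re (deriv h w)"
proof -
  define z where "z = inv_cayley \<tau> w"
  have z: "z \<in> ball 0 1" and cz: "cayley \<tau> z = w"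
    using inv_cayley_in_ball[OF \<tau> w] cayley_inv_cayley[OF \<tau> w] by (simp_all add: z_def)
  define W where "W t = cayley \<tau> (\<phi> t z)" for t
  have W0: "W 0 = w" using flow_0[OF z] cz by (simp add: W_def)
  obtain v where v: "((\<lambda>t. \<phi> t z) has_vector_derivative v) (at 0 within {0..1})"
    using flow_differentiable[OF z, of 0 1] by auto
  have "\<tau> - z \<noteq> 0" using \<tau> z by auto
  then have "cayley \<tau> field_differentiable at z"
    unfolding cayley_def[abs_def] by (intro derivative_intros) auto
  then obtain c where "(cayley \<tau> has_field_derivative c) (at (\<phi> 0 z))"
    unfolding field_differentiable_def using flow_0[OF z] by auto
  from field_vector_diff_chain_within[OF v has_field_derivative_at_within[OF this]]
  have W': "(W has_vector_derivative v * c) (at 0 within {0..1})"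
    by (simp add: o_def W_def[abs_def])
  have "(h has_field_derivative deriv h w) (at (W 0) within W ` {0..1})"
    using h_holomorphic w open_halfspace_Re_gt unfolding W0
    by (intro holomorphic_derivI) auto
  from field_vector_diff_chain_within[OF W' this]
  have "((\<lambda>t. h (W t)) has_vector_derivative v * c * deriv h w) (at 0 within {0..1})"
    by (simp add: o_def)
  moreover have "((\<lambda>t. h (W t)) has_vector_derivative 1) (at 0 within {0..1})"
  proof (rule has_vector_derivative_transform)
    have "((\<lambda>t. h w + of_real t) has_vector_derivative 0 + of_real 1) (at (0::real) within {0..1})"
      by (intro has_vector_derivative_add has_vector_derivative_const has_vector_derivative_of_real DERIV_ident)
    then show "((\<lambda>t. h w + of_real t) has_vector_derivative 1) (at (0::real) within {0..1})" by simp
  qed (use h_flow[OF z] cz in \<open>auto simp: W_def\<close>)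
  ultimately have eq: "v * c * deriv h w = 1"
    using vector_derivative_unique_within_closed_interval[of 0 1 0] unfolding cbox_interval by simp
  have "Re (W 0) \<le> Re (W t)" if "0 < t" for t
    using Re_cayley_flow[OF z, of t] that cz unfolding W0 by (simp add: W_def)
  with has_vector_derivative_Re_nonneg[OF W'] have "0 \<le> Re (v * c)" by simp
  moreover have "deriv h w = 1 / (v * c)" using eq by (simp add: eq_divide_eq mult.commute) auto
  ultimately show ?thesis by (simp only:) (simp add: Re_divide del: times_complex.sel)
qed

lemma cmod_cayley_flow_less:
  assumes st: "0 \<le> s" "s < t"
  shows "cmod (cayley \<tau> (\<phi> s 0)) < cmod (cayley \<tau> (\<phi> t 0))"
proof -
  define H where "H = {w::complex. 0 < Re w}"
  have H: "open H" "convex H" unfolding H_def by (rule open_halfspace_Re_gt convex_halfspace_Re_gt)+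
  have hol: "h holomorphic_on H" using h_holomorphic by (simp add: H_def)
  have W: "0 < Re (cayley \<tau> (\<phi> r 0))" "h (cayley \<tau> (\<phi> r 0)) = h 1 + of_real r" if "0 \<le> r" for r
    using h_flow[of 0 r] Re_cayley_pos[OF \<tau> flow_in_ball[of r 0]] that by simp_all
  consider "\<forall>w\<in>H. 0 < Re (deriv h w)" | "deriv h constant_on H" "\<exists>w\<in>H. Re (deriv h w) \<le> 0"
    using Re_nonneg_imp_pos_or_constant[of "deriv h" H] Re_deriv_h_nonneg H hol
    by (force simp: H_def intro: holomorphic_deriv convex_connected)
  then show ?thesis
  proof cases
    case 1
    interpret koenigs_map h
    proof
      show "h w + of_real t \<in> h ` {w. 0 < Re w}" if "0 < Re w" "0 \<le> t" for w t
      proof -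
        have z: "inv_cayley \<tau> w \<in> ball 0 1" "cayley \<tau> (inv_cayley \<tau> w) = w"
          using inv_cayley_in_ball[OF \<tau>] cayley_inv_cayley[OF \<tau>] that by simp_all
        have "h w + of_real t = h (cayley \<tau> (\<phi> t (inv_cayley \<tau> w)))"
          using h_flow[OF z(1)] z(2) that by simp
        moreover have "0 < Re (cayley \<tau> (\<phi> t (inv_cayley \<tau> w)))"
          using Re_cayley_pos[OF \<tau> flow_in_ball[OF _ z(1)]] that by simp
        ultimately show ?thesis by blast
      qed
    qed (use 1 h_holomorphic in \<open>auto simp: H_def\<close>)
    have "g (h 1 + of_real r) = cayley \<tau> (\<phi> r 0)" if "0 \<le> r" for r
      using g_h[OF W(1)[OF that]] W(2)[OF that] by simp
    then show ?thesis using cmod_orbit_strict_mono[OF st] st by simp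
  next
    \<comment> \<open>Now \<open>h\<close> is affine with imaginary slope \<open>c\<close>: the
      orbit of \<open>1\<close> runs along the vertical line through \<open>1\<close> at constant
      speed, and its squared modulus is explicit.\<close>
    case 2
    then obtain c where c: "\<And>w. w \<in> H \<Longrightarrow> deriv h w = c" by (auto simp: constant_on_def)
    have Re_c: "Re c = 0" using 2(2) Re_deriv_h_nonneg c by (fastforce simp: H_def)
    have "((\<lambda>w. h w - c * w) has_field_derivative 0) (at w within H)" if "w \<in> H" for w
      using holomorphic_derivI[OF hol H(1) that] c[OF that] by (auto intro!: derivative_eq_intros)
    then obtain k where "\<And>w. w \<in> H \<Longrightarrow> h w - c * w = k"
      using has_field_derivative_zero_constant[OF H(2)] by metis
    then have lin: "h w - c * w = h 1 - c * 1" if "w \<in> H" for w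
      using that by (metis H_def mem_Collect_eq one_complex.sel(1) zero_less_one)
    have c_eq: "c * (cayley \<tau> (\<phi> r 0) - 1) = of_real r" if "0 \<le> r" for r
      using lin[of "cayley \<tau> (\<phi> r 0)"] W[OF that] by (simp add: H_def right_diff_distrib) (simp add: algebra_simps)
    have "c \<noteq> 0" using c_eq[of 1] by auto
    then have "cayley \<tau> (\<phi> r 0) = 1 + of_real r / c" if "0 \<le> r" for r
      using c_eq[OF that] by (simp add: field_simps)
    moreover have "(cmod (1 + of_real r / c))\<^sup>2 = 1 + r\<^sup>2 * (cmod (1 / c))\<^sup>2" for r
    proof -
      have "Re (1 + of_real r / c) = 1" "Im (1 + of_real r / c) = r * Im (1 / c)" "Re (1 / c) = 0"
        using Re_c by (simp_all add: Re_divide Im_divide)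
      then show ?thesis unfolding cmod_power2 by (simp add: power_mult_distrib)
    qed
    ultimately have *: "(cmod (cayley \<tau> (\<phi> r 0)))\<^sup>2 = 1 + r\<^sup>2 * (cmod (1 / c))\<^sup>2" if "0 \<le> r" for r
      using that by simp
    have "s\<^sup>2 * (cmod (1 / c))\<^sup>2 < t\<^sup>2 * (cmod (1 / c))\<^sup>2"
      using st \<open>c \<noteq> 0\<close> by (intro mult_strict_right_mono power_strict_mono) auto
    then have "(cmod (cayley \<tau> (\<phi> s 0)))\<^sup>2 < (cmod (cayley \<tau> (\<phi> t 0)))\<^sup>2"
      using *[of s] *[of t] st by simp
    then show ?thesis by (rule power2_less_imp_less) simp
  qed
qed

lemma orthogonal_speed_eq:
  assumes "0 \<le> t"
  shows "orthogonal_speed \<phi> t = 1 / 2 * ln (cmod (cayley \<tau> (\<phi> t 0)))"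
    and "1 \<le> cmod (cayley \<tau> (\<phi> t 0))"
proof -
  have "1 \<le> Re (cayley \<tau> (\<phi> t 0))" using Re_cayley_flow[of 0 t] assms by simp
  also have "\<dots> \<le> cmod (cayley \<tau> (\<phi> t 0))" by (rule complex_Re_le_cmod)
  finally have m: "1 \<le> cmod (cayley \<tau> (\<phi> t 0))" .
  show "orthogonal_speed \<phi> t = 1 / 2 * ln (cmod (cayley \<tau> (\<phi> t 0)))"
    unfolding orthogonal_speed_def denjoy_wolff_point_eq
    by (rule hyp_dist_0_hyp_proj[OF \<tau> flow_in_ball[OF assms] m]) simp
  show "1 \<le> cmod (cayley \<tau> (\<phi> t 0))" by (rule m)
qed

end

theorem theorem1p1:
  fixes \<phi> :: "real \<Rightarrow> complex \<Rightarrow> complex"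
  assumes "disc_semigroup \<phi>" and "non_elliptic \<phi>"
  shows "strict_mono_on {0..} (orthogonal_speed \<phi>)"
proof -
  interpret disc_flow \<phi> by unfold_locales (rule assms)
  obtain \<tau> where \<tau>: "cmod \<tau> = 1"
    "\<And>z t. z \<in> ball 0 1 \<Longrightarrow> 0 \<le> t \<Longrightarrow> Re (cayley \<tau> z) \<le> Re (cayley \<tau> (\<phi> t z))"
    using common_horocycle_point[OF assms(2)] by blast
  obtain k where k: "k holomorphic_on ball 0 1"
    "\<And>z t. z \<in> ball 0 1 \<Longrightarrow> 0 \<le> t \<Longrightarrow> k (\<phi> t z) = k z + of_real t"
    using koenigs_function[OF assms(2)] by blast
  interpret non_elliptic_flow \<phi> \<tau> "k \<circ> inv_cayley \<tau>"
  proof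
    show "(k \<circ> inv_cayley \<tau>) holomorphic_on {w. 0 < Re w}"
      using inv_cayley_in_ball[OF \<tau>(1)]
      by (intro holomorphic_on_compose_gen[OF inv_cayley_holomorphic k(1)]) auto
    show "(k \<circ> inv_cayley \<tau>) (cayley \<tau> (\<phi> t z)) = (k \<circ> inv_cayley \<tau>) (cayley \<tau> z) + of_real t"
      if "z \<in> ball 0 1" "0 \<le> t" for z t
      using inv_cayley_cayley[OF \<tau>(1)] flow_in_ball k(2) that by simp
  qed (use \<tau> in auto)
  show ?thesis
  proof (rule strict_mono_onI)
    fix s t :: real assume "s \<in> {0..}" "t \<in> {0..}" and st: "s < t"
    then have "0 \<le> s" "0 \<le> t" by auto
    have "cmod (cayley \<tau> (\<phi> s 0)) < cmod (cayley \<tau> (\<phi> t 0))"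
      using cmod_cayley_flow_less \<open>0 \<le> s\<close> st .
    moreover have "0 < cmod (cayley \<tau> (\<phi> s 0))" using orthogonal_speed_eq(2)[OF \<open>0 \<le> s\<close>] by linarith
    ultimately show "orthogonal_speed \<phi> s < orthogonal_speed \<phi> t"
      unfolding orthogonal_speed_eq(1)[OF \<open>0 \<le> s\<close>] orthogonal_speed_eq(1)[OF \<open>0 \<le> t\<close>]
      by (intro mult_strict_left_mono ln_strict_mono) simp_all
  qed
qed

end
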